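(* Let $A$ be the moduli algebra of a complex hypersurface germ with an isolated singularity at the origin, let $\mathfrak m$ be its maximal ideal, and suppose that for some natural number $N$ the ideal $\mathfrak m^N$ is one-dimensional over $\mathbb C$ and $\mathfrak m^{N+1}=0$. Let $a\in\bigodot^N(\mathfrak m/\mathfrak m^2)^*$ be the multiplication tensor of $A$ (well defined up to a non-zero scale factor). Suppose $P$ and $Q$ are classical invariants of tensors of this type, homogeneous polynomials of the same degree, and suppose that $Q(a)\neq 0$. Then $P/Q$ is an absolute invariant of the algebra $A$. More precisely, if $B$ is a complex algebra isomorphic to $A$, then $B$ is also local; its maximal ideal $\mathfrak n$ has the same dimension over $\mathbb C$ as $\mathfrak m$; $\mathfrak n^N$ is one-dimensional and $\mathfrak n^{N+1}=0$; and the value of $P/Q$ computed for the multiplication tensor $\bigodot^N(\mathfrak n/\mathfrak n^2)\to\mathfrak n^N$ of $B$ is the same as the value $P(a)/Q(a)$ computed for $A$ (these values being independent of all choices of bases used to compute them).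
   Context: Moduli algebra: let $V$ be a complex hypersurface in $\mathbb C^n$ with an isolated singularity at the origin, written near the origin as the zero locus of a holomorphic function $f(z_1,\dots,z_n)$ (a generator of the ideal of $V$). Its moduli algebra is $$A=\mathbb C\{z_1,\dots,z_n\}/(f,\partial f/\partial z_1,\dots,\partial f/\partial z_n),$$ where $\mathbb C\{z_1,\dots,z_n\}$ is the ring of convergent power series. It is a finite-dimensional commutative local $\mathbb C$-algebra, whose unique maximal ideal $\mathfrak m$ is generated by $z_1,\dots,z_n$. Multiplication tensor: if $\mathfrak m^{N+1}=0$ and $\dim_{\mathbb C}\mathfrak m^N=1$, then multiplication in the algebra induces a linear map $\bigodot^N(\mathfrak m/\mathfrak m^2)\to\mathfrak m^N$ (where $\bigodot^N$ is the $N$-th symmetric power). Choosing an isomorphism $\mathfrak m^N\cong\mathbb C$, this is a tensor $a\in\bigodot^N(\mathfrak m/\mathfrak m^2)^*$, canonically defined up to non-zero scale. The same construction applies to any finite-dimensional commutative local $\mathbb C$-algebra $B$ with maximal ideal $\mathfrak n$ satisfying $\mathfrak n^{N+1}=0$, $\dim_{\mathbb C}\mathfrak n^N=1$. Classical invariants: a classical invariant of tensors in $\bigodot^N(\mathfrak m/\mathfrak m^2)^*$ is a polynomial in the coefficients of such a tensor that is invariant under the natural action of $\mathrm{SL}(\mathfrak m/\mathfrak m^2)$. With $r=\dim_{\mathbb C}\mathfrak m/\mathfrak m^2$, choosing a basis of $\mathfrak m/\mathfrak m^2$ identifies such polynomials with $\mathrm{SL}(r,\mathbb C)$-invariant polynomials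 on $\bigodot^N(\mathbb C^r)^*$. To compute such a polynomial for another algebra $B$ with $\dim_{\mathbb C}\mathfrak n/\mathfrak n^2=r$, one chooses a basis of $\mathfrak n/\mathfrak n^2$ and a basis of $\mathfrak n^N$ and evaluates the polynomial on the resulting coefficients of the multiplication tensor of $B$. *)

theory Defs
  imports
    "HOL-Analysis.Analysis"
    "HOL-Library.Poly_Mapping"
    "Jordan_Normal_Form.VS_Connect"
    "HOL-Algebra.QuotRing"
    "HOL-Algebra.Ideal_Product"
    "HOL-Algebra.Module"
begin

section \<open>Convergent power series in several variables\<close>

text \<open>A power series in variables indexed by \<^typ>\<open>'n\<close> is its family of coefficients,
  indexed by exponent vectors. Convergence is unconditional convergence of the multiple
  series in a neighbourhood of the origin.\<close>

type_synonym 'n power_series = "('n \<Rightarrow> nat) \<Rightarrow> complex"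

definition ps_term :: "'n::finite power_series \<Rightarrow> complex ^ 'n \<Rightarrow> ('n \<Rightarrow> nat) \<Rightarrow> complex" where
  "ps_term f z \<alpha> = f \<alpha> * (\<Prod>i\<in>UNIV. vec_nth z i ^ \<alpha> i)"

definition convergent_ps :: "'n::finite power_series \<Rightarrow> bool" where
  "convergent_ps f \<longleftrightarrow> (\<exists>\<epsilon>>0. \<forall>z\<in>ball 0 \<epsilon>. ps_term f z summable_on UNIV)"

definition ps_eval :: "'n::finite power_series \<Rightarrow> complex ^ 'n \<Rightarrow> complex" where
  "ps_eval f z = infsum (ps_term f z) UNIV"

definition ps_mult :: "'n::finite power_series \<Rightarrow> 'n power_series \<Rightarrow> 'n power_series" where
  "ps_mult f g = (\<lambda>\<gamma>. \<Sum>\<beta> | \<beta> \<le> \<gamma>. f \<beta> * g (\<lambda>i. \<gamma> i - \<beta> i))"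

definition ps_pderiv :: "'n \<Rightarrow> 'n power_series \<Rightarrow> 'n power_series" where
  "ps_pderiv i f = (\<lambda>\<alpha>. of_nat (\<alpha> i + 1) * f (\<alpha>(i := \<alpha> i + 1)))"

definition convergent_power_series :: "(complex, 'n::finite power_series) module" where
  "convergent_power_series =
    \<lparr>carrier = {f. convergent_ps f}, mult = ps_mult,
     one = (\<lambda>\<alpha>. if \<alpha> = (\<lambda>_. 0) then 1 else 0), zero = (\<lambda>_. 0),
     add = (\<lambda>f g \<alpha>. f \<alpha> + g \<alpha>), smult = (\<lambda>c f \<alpha>. c * f \<alpha>)\<rparr>"


section \<open>Hypersurface germs with an isolated singularity\<close>

definition germ_ideal :: "(complex ^ 'n::finite) set \<Rightarrow> 'n power_series set" where
  "germ_ideal V = {g. convergent_ps g \<and> (\<forall>\<^sub>F z in nhds 0. z \<in> V \<longrightarrow> ps_eval g z = 0)}"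

text \<open>Near a smooth point \<open>p\<close> the hypersurface is a complex submanifold of codimension one: the
  zero set of a holomorphic \<open>g\<close> with nonvanishing differential at \<open>p\<close>. The function \<open>g\<close> is given
  by its Taylor series at \<open>p\<close>, so the partial derivatives of \<open>g\<close> at \<open>p\<close> are the constant terms
  of the formal ones.\<close>

definition smooth_point :: "(complex ^ 'n::finite) set \<Rightarrow> complex ^ 'n \<Rightarrow> bool" where
  "smooth_point V p \<longleftrightarrow> p \<in> V \<and>
     (\<exists>g. convergent_ps g \<and> (\<forall>\<^sub>F z in nhds p. z \<in> V \<longleftrightarrow> ps_eval g (z - p) = 0) \<and>
          (\<exists>i. ps_pderiv i g (\<lambda>_. 0) \<noteq> 0))"

definition isolated_singularity :: "(complex ^ 'n::finite) set \<Rightarrow> bool" where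
  "isolated_singularity V \<longleftrightarrow>
     0 \<in> V \<and> \<not> smooth_point V 0 \<and> (\<forall>\<^sub>F p in at 0. p \<in> V \<longrightarrow> smooth_point V p)"

definition hypersurface_germ_generator ::
    "(complex ^ 'n::finite) set \<Rightarrow> 'n power_series \<Rightarrow> bool" where
  "hypersurface_germ_generator V f \<longleftrightarrow>
     convergent_ps f \<and> (\<forall>\<^sub>F z in nhds 0. z \<in> V \<longleftrightarrow> ps_eval f z = 0) \<and>
     germ_ideal V = PIdl\<^bsub>convergent_power_series\<^esub> f"


section \<open>Complex algebras and their quotients\<close>

abbreviation complex_field :: "complex ring" where
  "complex_field \<equiv> class_ring"

text \<open>The ring \<^term>\<open>R Quot I\<close> with its induced scalar multiplication.\<close>

definition alg_quot :: "(complex, 'a) module \<Rightarrow> 'a set \<Rightarrow> (complex, 'a set) module" where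
  "alg_quot R I =
    \<lparr>carrier = carrier (R Quot I), mult = mult (R Quot I), one = one (R Quot I),
     zero = zero (R Quot I), add = add (R Quot I),
     smult = (\<lambda>c X. \<Union>x\<in>X. I +>\<^bsub>R\<^esub> (c \<odot>\<^bsub>R\<^esub> x))\<rparr>"

definition moduli_algebra ::
    "'n::finite power_series \<Rightarrow> (complex, 'n power_series set) module" where
  "moduli_algebra f = alg_quot convergent_power_series
     (Idl\<^bsub>convergent_power_series\<^esub> (insert f (range (\<lambda>i. ps_pderiv i f))))"

definition algebra_iso :: "(complex, 'a) module \<Rightarrow> (complex, 'b) module \<Rightarrow> ('a \<Rightarrow> 'b) set" where
  "algebra_iso A B =
     {\<phi> \<in> ring_iso A B. \<forall>c. \<forall>x\<in>carrier A. \<phi> (c \<odot>\<^bsub>A\<^esub> x) = c \<odot>\<^bsub>B\<^esub> \<phi> x}"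

abbreviation ideal_power :: "(complex, 'a) module \<Rightarrow> 'a set \<Rightarrow> nat \<Rightarrow> 'a set" where
  "ideal_power A I k \<equiv> I [^]\<^bsub>ideals_set A\<^esub> k"

abbreviation subspace_of :: "(complex, 'a) module \<Rightarrow> 'a set \<Rightarrow> (complex, 'a) module" where
  "subspace_of A W \<equiv> A\<lparr>carrier := W\<rparr>"

text \<open>\<open>\<mm>/\<mm>\<^sup>2\<close>, as a subspace of the quotient algebra by \<open>\<mm>\<^sup>2\<close>.\<close>

definition cotangent_space :: "(complex, 'a) module \<Rightarrow> 'a set \<Rightarrow> (complex, 'a set) module" where
  "cotangent_space A \<mm> =
     subspace_of (alg_quot A (ideal_power A \<mm> 2)) {ideal_power A \<mm> 2 +>\<^bsub>A\<^esub> x | x. x \<in> \<mm>}"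

text \<open>The library's dimension is a natural number, meaningful only together with
  finite-dimensionality.\<close>

definition has_dim :: "(complex, 'a) module \<Rightarrow> nat \<Rightarrow> bool" where
  "has_dim W d \<longleftrightarrow> vectorspace.fin_dim complex_field W \<and> vectorspace.dim complex_field W = d"

definition ordered_basis :: "(complex, 'a) module \<Rightarrow> nat \<Rightarrow> (nat \<Rightarrow> 'a) \<Rightarrow> bool" where
  "ordered_basis W r e \<longleftrightarrow>
     inj_on e {..<r} \<and> vectorspace.basis complex_field W (e ` {..<r})"


section \<open>The multiplication tensor\<close>

text \<open>The product of a list of residue classes, computed on representatives. For \<open>N\<close> classes in
  \<open>\<mm>/\<mm>\<^sup>2\<close> with \<open>\<mm>\<close> an ideal such that \<open>\<mm>\<^bsup>N+1\<^esup> = 0\<close>, it does not depend on the representatives.\<close>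

definition class_product :: "(complex, 'a) module \<Rightarrow> 'a set list \<Rightarrow> 'a" where
  "class_product A Xs =
     (THE y. \<forall>xs. list_all2 (\<in>) xs Xs \<longrightarrow> foldr (mult A) xs \<one>\<^bsub>A\<^esub> = y)"

text \<open>Coefficients of the multiplication tensor for the basis \<open>e\<close> of \<open>\<mm>/\<mm>\<^sup>2\<close>
  and the basis vector \<open>w\<close> of \<open>\<mm>\<^sup>N\<close>. Only index lists of length \<open>N\<close> are meaningful.\<close>

definition mult_tensor ::
    "(complex, 'a) module \<Rightarrow> (nat \<Rightarrow> 'a set) \<Rightarrow> 'a \<Rightarrow> nat list \<Rightarrow> complex" where
  "mult_tensor A e w is = (THE c. class_product A (map e is) = c \<odot>\<^bsub>A\<^esub> w)"


section \<open>Classical invariants of symmetric tensors\<close>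

definition tensor_indices :: "nat \<Rightarrow> nat \<Rightarrow> nat list set" where
  "tensor_indices r N = {is. length is = N \<and> set is \<subseteq> {..<r}}"

definition sym_tensors :: "nat \<Rightarrow> nat \<Rightarrow> (nat list \<Rightarrow> complex) set" where
  "sym_tensors r N =
     {a. \<forall>is\<in>tensor_indices r N. \<forall>js\<in>tensor_indices r N. mset is = mset js \<longrightarrow> a is = a js}"

text \<open>The tensor \<open>(v\<^sub>1, \<dots>, v\<^sub>N) \<mapsto> a (g v\<^sub>1, \<dots>, g v\<^sub>N)\<close>. This is the action of the inverse
  of \<open>g\<close>; the invariants of the group are the same.\<close>

definition tensor_act ::
    "nat \<Rightarrow> nat \<Rightarrow> complex mat \<Rightarrow> (nat list \<Rightarrow> complex) \<Rightarrow> nat list \<Rightarrow> complex" where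
  "tensor_act r N g a js =
     (\<Sum>is\<in>tensor_indices r N. (\<Prod>k<N. g $$ (is ! k, js ! k)) * a is)"

text \<open>Polynomials whose variables are the coefficients of a tensor; the outer keys are
  monomials, given by the exponents of the variables.\<close>

type_synonym tensor_poly = "(nat list \<Rightarrow>\<^sub>0 nat) \<Rightarrow>\<^sub>0 complex"

definition poly_on :: "nat list set \<Rightarrow> tensor_poly \<Rightarrow> bool" where
  "poly_on X P \<longleftrightarrow> (\<forall>\<mu>\<in>Poly_Mapping.keys P. Poly_Mapping.keys \<mu> \<subseteq> X)"

definition homogeneous :: "nat \<Rightarrow> tensor_poly \<Rightarrow> bool" where
  "homogeneous d P \<longleftrightarrow>
     (\<forall>\<mu>\<in>Poly_Mapping.keys P. (\<Sum>x\<in>Poly_Mapping.keys \<mu>. Poly_Mapping.lookup \<mu> x) = d)"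

definition poly_value :: "tensor_poly \<Rightarrow> (nat list \<Rightarrow> complex) \<Rightarrow> complex" where
  "poly_value P a =
     (\<Sum>\<mu>\<in>Poly_Mapping.keys P. Poly_Mapping.lookup P \<mu> *
        (\<Prod>x\<in>Poly_Mapping.keys \<mu>. a x ^ Poly_Mapping.lookup \<mu> x))"

definition classical_invariant :: "nat \<Rightarrow> nat \<Rightarrow> tensor_poly \<Rightarrow> bool" where
  "classical_invariant r N P \<longleftrightarrow>
     poly_on (tensor_indices r N) P \<and>
     (\<forall>g\<in>carrier_mat r r. Determinant.det g = 1 \<longrightarrow>
        (\<forall>a\<in>sym_tensors r N. poly_value P (tensor_act r N g a) = poly_value P a))"

end

theory Submission
  imports Defs "HOL-Algebra.Divisibility" "HOL-Algebra.Multiplicative_Group"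
begin

text \<open>
  Let \<open>x\<^sub>i \<in> \<mm>\<close> be representatives of a basis of \<open>\<mm>/\<mm>\<^sup>2\<close>, and let \<open>w\<close> span \<open>\<mm>\<^sup>N\<close>. Because
  \<open>\<mm>\<close> has vanishing power \<open>N + 1\<close>, an \<open>N\<close>-fold product of elements of \<open>\<mm>\<close> does not notice a
  change of its factors modulo \<open>\<mm>\<^sup>2\<close>. So the multiplication tensor \<open>a\<close> is computed with
  representatives: the product of \<open>x\<^sub>i\<close> over an index list is the corresponding coefficient of \<open>a\<close>
  times \<open>w\<close> (\<open>mult_tensor_eq\<close>).

  Everything about the choice of bases follows by expanding products. Representatives of another
  basis are \<open>x'\<^sub>j = \<Sum>\<^sub>i g\<^sub>i\<^sub>j x\<^sub>i\<close> modulo \<open>\<mm>\<^sup>2\<close> with an invertible matrix \<open>g\<close>, and \<open>w = c w'\<close> with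
  \<open>c \<noteq> 0\<close>; multilinearity turns \<open>a\<close> into \<open>c\<close> times the transform of \<open>a\<close> under \<open>g\<close>
  (\<open>mult_tensor_change_of_basis\<close>). Over the complex numbers \<open>g = s h\<close> with \<open>det h = 1\<close>, and the scalar
  \<open>s\<close> multiplies a tensor of order \<open>N\<close> by \<open>s\<^sup>N\<close>. Hence a classical invariant that is homogeneous of
  degree \<open>d\<close> is multiplied by the \<open>d\<close>-th power of \<open>c s\<^sup>N\<close>, a factor that is the same for \<open>P\<close> and
  for \<open>Q\<close> and cancels in \<open>P/Q\<close> (\<open>invariant_ratio_change_of_basis\<close>).

  An isomorphism \<open>\<phi>\<close> from \<open>A\<close> to \<open>B\<close> maps ideals, their powers and their cosets to those of \<open>B\<close>, and
  therefore does not change the coefficients of the tensor (\<open>mult_tensor_image\<close>). Bases chosen in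
  \<open>B\<close> are pulled back along the inverse of \<open>\<phi>\<close>, which reduces the claim about \<open>B\<close> to the change of
  basis in \<open>A\<close>. The image of \<open>\<mm>\<close> is the only maximal ideal of \<open>B\<close> because a prime ideal contains
  every nilpotent element (\<open>maximal_ideal_unique\<close>). The dimension of \<open>\<mm>\<close> is finite because \<open>\<mm>\<close> is
  spanned by the monomials in the \<open>x\<^sub>i\<close>, of which only those of degree at most \<open>N\<close> can be non-zero
  (\<open>finite_dimensional\<close>).
\<close>

section \<open>Coordinates in complex vector spaces\<close>

lemma vectorspace_if_module:
  "Module.module complex_field M \<Longrightarrow> vectorspace complex_field M"
  by (intro vectorspace.intro class_field)

lemma vectorspace_subspace_of:
  assumes "Module.module complex_field M" "LinearCombinations.submodule complex_field W M"
  shows "vectorspace complex_field (subspace_of M W)"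
  by (rule vectorspace.subspace_is_vs)
     (use assms in \<open>auto intro: vectorspace_if_module subspace.intro\<close>)

text \<open>A basis is a set of vectors, and its coefficient functions are defined on that set. The next two
  lemmas pass to bases indexed by \<open>{..<r}\<close>, which is how matrices and tensors refer to them.\<close>

lemma ordered_basis_coordinates:
  assumes "vectorspace complex_field W" "ordered_basis W r e" "v \<in> carrier W"
  obtains c where "v = (\<Oplus>\<^bsub>W\<^esub>i\<in>{..<r}. c i \<odot>\<^bsub>W\<^esub> e i)"
proof -
  interpret W: vectorspace complex_field W by fact
  have inj: "inj_on e {..<r}" and basis: "W.basis (e ` {..<r})"
    using assms(2) by (auto simp: ordered_basis_def)
  then have sub: "e ` {..<r} \<subseteq> carrier W"
    by (simp add: W.basis_def)
  obtain a where a: "W.lincomb a (e ` {..<r}) = v"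
    using basis assms(3) W.basis_criterion[OF _ sub] by blast
  have "v = (\<Oplus>\<^bsub>W\<^esub>i\<in>{..<r}. a (e i) \<odot>\<^bsub>W\<^esub> e i)"
    unfolding a[symmetric] W.lincomb_def using inj sub
    by (subst W.M.add.finprod_reindex) (auto simp: Pi_def)
  then show ?thesis by (rule that)
qed

lemma ordered_basis_coordinates_unique:
  assumes "vectorspace complex_field W" "ordered_basis W r e"
    and eq: "(\<Oplus>\<^bsub>W\<^esub>i\<in>{..<r}. c i \<odot>\<^bsub>W\<^esub> e i) = (\<Oplus>\<^bsub>W\<^esub>i\<in>{..<r}. d i \<odot>\<^bsub>W\<^esub> e i)"
    and i: "i < r"
  shows "c i = d i"
proof -
  interpret W: vectorspace complex_field W by fact
  have inj: "inj_on e {..<r}" and basis: "W.basis (e ` {..<r})"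
    using assms(2) by (auto simp: ordered_basis_def)
  then have sub: "e ` {..<r} \<subseteq> carrier W"
    by (simp add: W.basis_def)
  \<comment> \<open>Coefficients indexed by basis vectors; they have to be extensional because the
    uniqueness of coordinates is a statement about extensional functions.\<close>
  define coeffs where "coeffs c = restrict (\<lambda>v. c (the_inv_into {..<r} e v)) (e ` {..<r})"
    for c :: "nat \<Rightarrow> complex"
  have lincomb: "W.lincomb (coeffs c) (e ` {..<r}) = (\<Oplus>\<^bsub>W\<^esub>i\<in>{..<r}. c i \<odot>\<^bsub>W\<^esub> e i)" for c
  proof -
    have "W.lincomb (coeffs c) (e ` {..<r}) = (\<Oplus>\<^bsub>W\<^esub>i\<in>{..<r}. coeffs c (e i) \<odot>\<^bsub>W\<^esub> e i)"
      unfolding W.lincomb_def using inj sub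
      by (subst W.M.add.finprod_reindex) (auto simp: Pi_def)
    also have "\<dots> = (\<Oplus>\<^bsub>W\<^esub>i\<in>{..<r}. c i \<odot>\<^bsub>W\<^esub> e i)"
      using sub by (intro W.M.finsum_cong') (auto simp: coeffs_def the_inv_into_f_f[OF inj])
    finally show ?thesis .
  qed
  have "\<exists>!a. a \<in> e ` {..<r} \<rightarrow>\<^sub>E UNIV \<and> W.lincomb a (e ` {..<r}) = W.lincomb (coeffs c) (e ` {..<r})"
    using basis W.basis_criterion[OF _ sub] W.lincomb_closed[OF sub, of "coeffs c"] by auto
  then have "coeffs c = coeffs d"
  proof (rule ex1E)
    fix a assume "\<forall>b. b \<in> e ` {..<r} \<rightarrow>\<^sub>E UNIV \<and> W.lincomb b (e ` {..<r}) = W.lincomb (coeffs c) (e ` {..<r}) \<longrightarrow> b = a"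
    moreover have "coeffs c \<in> e ` {..<r} \<rightarrow>\<^sub>E UNIV" "coeffs d \<in> e ` {..<r} \<rightarrow>\<^sub>E UNIV"
      by (auto simp: coeffs_def)
    moreover have "W.lincomb (coeffs d) (e ` {..<r}) = W.lincomb (coeffs c) (e ` {..<r})"
      using lincomb eq by simp
    ultimately show ?thesis by metis
  qed
  then have "coeffs c (e i) = coeffs d (e i)" by simp
  then show ?thesis
    using i by (simp add: coeffs_def the_inv_into_f_f[OF inj])
qed

lemma has_dim_if_ordered_basis:
  assumes "vectorspace complex_field W" "ordered_basis W r e"
  shows "has_dim W r"
proof -
  interpret W: vectorspace complex_field W by fact
  have inj: "inj_on e {..<r}" and basis: "W.basis (e ` {..<r})"
    using assms(2) by (auto simp: ordered_basis_def)
  have "W.fin_dim" using basis unfolding W.fin_dim_def W.basis_def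
    by (metis finite_imageI finite_lessThan)
  moreover have "W.dim = r"
    using W.dim_basis[OF _ basis] inj by (simp add: card_image)
  ultimately show ?thesis by (simp add: has_dim_def)
qed

lemma linear_bijection_has_dim:
  assumes "linear_map complex_field V W T" "bij_betw T (carrier V) (carrier W)" "has_dim V k"
  shows "has_dim W k"
proof -
  interpret linear_map complex_field V W T by fact
  show ?thesis
    using assms dim_eq surj_fin_dim by (auto simp: has_dim_def bij_betw_def)
qed

lemma linear_bijection_ordered_basis:
  assumes "linear_map complex_field V W T" "bij_betw T (carrier V) (carrier W)" "ordered_basis V r e"
  shows "ordered_basis W r (T \<circ> e)"
proof -
  interpret linear_map complex_field V W T by fact
  have inj: "inj_on e {..<r}" and basis: "V.basis (e ` {..<r})"
    using assms(3) by (auto simp: ordered_basis_def)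
  have "V.fin_dim" using basis unfolding V.fin_dim_def V.basis_def
    by (metis finite_imageI finite_lessThan)
  then have "W.basis (T ` e ` {..<r})"
    using assms(2) linear_inj_image_is_basis basis by (auto simp: bij_betw_def)
  moreover have "inj_on (T \<circ> e) {..<r}"
    using assms(2) inj basis
    by (intro comp_inj_on) (auto simp: bij_betw_def V.basis_def intro: inj_on_subset)
  ultimately show ?thesis by (simp add: ordered_basis_def image_comp)
qed

text \<open>This makes the coordinate lemmas available on the line \<open>\<mm>\<^sup>N\<close>.\<close>

lemma ordered_basis_singleton:
  "ordered_basis W (Suc 0) (\<lambda>_. w) \<longleftrightarrow> vectorspace.basis complex_field W {w}"
  by (simp add: ordered_basis_def lessThan_Suc)

section \<open>Ideals and quotients of complex algebras\<close>

lemma alg_quot_simps: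
  "carrier (alg_quot R I) = a_rcosets\<^bsub>R\<^esub> I"
  "x \<otimes>\<^bsub>alg_quot R I\<^esub> y = rcoset_mult R I x y"
  "\<one>\<^bsub>alg_quot R I\<^esub> = I +>\<^bsub>R\<^esub> \<one>\<^bsub>R\<^esub>"
  "\<zero>\<^bsub>alg_quot R I\<^esub> = I"
  "x \<oplus>\<^bsub>alg_quot R I\<^esub> y = x <+>\<^bsub>R\<^esub> y"
  by (simp_all add: alg_quot_def FactRing_def)

lemma cring_alg_quot:
  assumes "cring R" "ideal I R"
  shows "cring (alg_quot R I)"
proof -
  interpret ideal I R by fact
  interpret Q: cring "R Quot I" using assms(1) by (rule quotient_is_cring)
  have "id \<in> ring_iso (R Quot I) (alg_quot R I)"
    by (rule ring_iso_memI) (auto simp: alg_quot_def)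
  from Q.ring_iso_imp_img_cring[OF this] show ?thesis
    by (simp add: alg_quot_def)
qed

text \<open>A scalar acts on \<open>A\<close> as multiplication by a multiple of the unit, so every ideal in the sense of
  ring theory is also a linear subspace.\<close>

locale algebra_ideal = algebra?: Module.algebra complex_field A + ideal I A
  for A :: "(complex, 'a) module" (structure) and I
begin

lemma smult_eq_mult: "x \<in> carrier A \<Longrightarrow> c \<odot> x = (c \<odot> \<one>) \<otimes> x"
  using algebra.smult_assoc2[of c "\<one>" x] by simp

lemma smult_in_ideal: "x \<in> I \<Longrightarrow> c \<odot> x \<in> I"
  using smult_eq_mult[of x c] I_l_closed[of x "c \<odot> \<one>"] a_Hcarr by simp

lemma mult_smult: "x \<in> carrier A \<Longrightarrow> y \<in> carrier A \<Longrightarrow> x \<otimes> (c \<odot> y) = c \<odot> (x \<otimes> y)"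
  using algebra.smult_assoc2[of c y x] by (simp add: algebra.m_comm)

lemma submodule_ideal: "LinearCombinations.submodule complex_field I A"
  using a_Hcarr smult_in_ideal algebra.module
  by (intro submodule.intro) (auto simp: a_closed)

text \<open>The scalar multiple of a coset is defined as a union over all its elements. Since \<open>I\<close> is a linear
  subspace, all members of this union are the same coset.\<close>

lemma smult_coset:
  assumes "x \<in> carrier A"
  shows "c \<odot>\<^bsub>alg_quot A I\<^esub> (I +> x) = I +> (c \<odot> x)"
proof -
  have rep: "I +> (c \<odot> y) = I +> (c \<odot> x)" if y: "y \<in> I +> x" for y
  proof -
    from y obtain h where h: "h \<in> I" "y = h \<oplus> x" by (auto simp: a_r_coset_def')
    then have "c \<odot> y = c \<odot> h \<oplus> c \<odot> x"
      using assms a_Hcarr algebra.smult_r_distr[of c h x] by simp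
    then have "c \<odot> y \<in> I +> (c \<odot> x)"
      using smult_in_ideal[OF h(1)] by (auto simp: a_r_coset_def')
    then show ?thesis using assms a_repr_independence'[of "c \<odot> y" "c \<odot> x"] by simp
  qed
  have "c \<odot>\<^bsub>alg_quot A I\<^esub> (I +> x) = (\<Union>y\<in>I +> x. I +> (c \<odot> y))"
    by (simp add: alg_quot_def)
  also have "\<dots> = (\<Union>y\<in>I +> x. I +> (c \<odot> x))"
    by (rule SUP_cong[OF refl rep])
  also have "\<dots> = I +> (c \<odot> x)"
    using a_rcos_self[OF assms] by (metis UN_constant empty_iff)
  finally show ?thesis .
qed

lemma coset_eq_iff:
  assumes "x \<in> carrier A" "y \<in> carrier A"
  shows "I +> x = I +> y \<longleftrightarrow> x \<ominus> y \<in> I"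
  using assms a_rcos_module_minus[OF ring_axioms, of y x] a_rcos_self[of x] a_repr_independence'[of x y]
  by auto

lemma algebra_alg_quot: "Module.algebra complex_field (alg_quot A I)"
proof -
  have cring: "cring (alg_quot A I)"
    using algebra.M_cring ideal_axioms by (rule cring_alg_quot)
  have carrier: "\<exists>x\<in>carrier A. X = I +> x" if "X \<in> carrier (alg_quot A I)" for X
    using that by (auto simp: alg_quot_simps A_RCOSETS_def')
  show ?thesis
  proof (rule algebraI[OF _ cring], goal_cases)
    case 1 show ?case by (rule class_cring.cring_axioms)
  next
    case (2 c X)
    then show ?case using carrier[of X] smult_coset
      by (auto simp: alg_quot_simps intro!: a_rcosetsI a_subset)
  next
    case (3 a b X)
    then obtain x where "x \<in> carrier A" "X = I +> x" using carrier by blast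
    then show ?case 
      by (simp add: smult_coset algebra.smult_l_distr[of a b, simplified] alg_quot_simps(5) a_rcos_sum)
  next
    case (4 a X Y)
    then obtain x y where "x \<in> carrier A" "X = I +> x" "y \<in> carrier A" "Y = I +> y" using carrier by meson
    then show ?case 
      by (simp add: smult_coset algebra.smult_r_distr alg_quot_simps(5) a_rcos_sum)
  next
    case (5 a b X)
    then obtain x where "x \<in> carrier A" "X = I +> x" using carrier by blast
    then show ?case 
      by (simp add: smult_coset algebra.smult_assoc1[of a b, simplified])
  next
    case (6 X)
    then obtain x where "x \<in> carrier A" "X = I +> x" using carrier by blast
    then show ?case using algebra.smult_one[of x]
      by (simp add: smult_coset)
  next
    case (7 a X Y)
    then obtain x y where "x \<in> carrier A" "X = I +> x" "y \<in> carrier A" "Y = I +> y" using carrier by meson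
    then show ?case 
      by (simp add: smult_coset algebra.smult_assoc2 alg_quot_simps(2) rcoset_mult_add)
  qed
qed

lemma coset_module_hom: "(+>) I \<in> module_hom complex_field A (alg_quot A I)"
  by (auto simp: module_hom_def alg_quot_simps smult_coset a_rcos_sum intro!: a_rcosetsI a_subset)

end

section \<open>Powers of an ideal\<close>

context algebra_ideal
begin

lemma ideal_power_0: "ideal_power A I 0 = carrier A"
  by (simp add: ideals_set_def)

lemma ideal_power_Suc: "ideal_power A I (Suc k) = ideal_prod A (ideal_power A I k) I"
  by (simp add: ideals_set_def)

lemma ideal_ideal_power: "ideal (ideal_power A I k) A"
proof (induction k)
  case 0 show ?case unfolding ideal_power_0 by (rule oneideal)
next
  case (Suc k) show ?case unfolding ideal_power_Suc by (rule ideal_prod_is_ideal[OF Suc ideal_axioms])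
qed

lemma ideal_power_subset: "ideal_power A I k \<subseteq> carrier A"
  using ideal.Icarr[OF ideal_ideal_power] by blast

lemma ideal_power_1: "ideal_power A I (Suc 0) = I"
  unfolding ideal_power_Suc ideal_power_0
  using algebra.ideal_prod_commute[OF oneideal ideal_axioms] ideal_prod_one[OF ideal_axioms] by simp

text \<open>Powers of an ideal form powers in the monoid of ideals, so exponents add.\<close>

lemma mult_in_ideal_power:
  assumes "x \<in> ideal_power A I j" "y \<in> ideal_power A I k"
  shows "x \<otimes> y \<in> ideal_power A I (j + k)"
proof -
  have "monoid (ideals_set A)"
    using algebra.ideals_set_is_comm_monoid by (rule comm_monoid.axioms)
  then have "ideal_prod A (ideal_power A I j) (ideal_power A I k) = ideal_power A I (j + k)"
    using monoid.nat_pow_mult[of "ideals_set A" I j k] ideal_axioms by (simp add: ideals_set_def)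
  then show ?thesis using ideal_prod.prod[OF assms, of A] by simp
qed

lemma list_prod_closed: "set xs \<subseteq> carrier A \<Longrightarrow> foldr (\<otimes>) xs \<one> \<in> carrier A"
  by (induction xs) auto

lemma list_prod_append:
  assumes "set xs \<subseteq> carrier A" "set ys \<subseteq> carrier A"
  shows "foldr (\<otimes>) (xs @ ys) \<one> = foldr (\<otimes>) xs \<one> \<otimes> foldr (\<otimes>) ys \<one>"
  using assms by (induction xs) (auto simp: list_prod_closed m_assoc)

lemma list_prod_in_ideal_power: "set xs \<subseteq> I \<Longrightarrow> foldr (\<otimes>) xs \<one> \<in> ideal_power A I (length xs)"
proof (induction xs)
  case Nil show ?case by (simp add: ideals_set_def)
next
  case (Cons x xs)
  have "x \<otimes> foldr (\<otimes>) xs \<one> \<in> ideal_power A I (Suc 0 + length xs)"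
    by (rule mult_in_ideal_power) (use Cons ideal_power_1 in auto)
  then show ?case by simp
qed

text \<open>Replacing the factors one at a time changes the product by a sum of terms that each contain one
  factor from \<open>I\<^sup>2\<close> and otherwise factors from \<open>I\<close>, hence by an element of one power more than the
  number of factors.\<close>

lemma list_prod_congruent:
  assumes "list_all2 (\<lambda>x y. x \<in> I \<and> y \<in> I \<and> x \<ominus> y \<in> ideal_power A I 2) xs ys"
  shows "foldr (\<otimes>) xs \<one> \<ominus> foldr (\<otimes>) ys \<one> \<in> ideal_power A I (Suc (length xs))"
  using assms
proof (induction rule: list_all2_induct)
  case Nil
  then show ?case using ideal_power_1 additive_subgroup.zero_closed[OF ideal.axioms(1)[OF ideal_axioms]]
    by (simp add: minus_eq r_neg)
next
  case (Cons x xs y ys)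
  let ?p = "foldr (\<otimes>) xs \<one>" and ?q = "foldr (\<otimes>) ys \<one>"
  have sub: "set xs \<subseteq> I" "set ys \<subseteq> I"
    using Cons(2) by (auto simp: list_all2_conv_all_nth in_set_conv_nth)
  have carr: "x \<in> carrier A" "y \<in> carrier A" "?p \<in> carrier A" "?q \<in> carrier A"
    using Cons(1) sub a_subset by (auto intro!: list_prod_closed)
  \<comment> \<open>The telescoping step: \<open>x p - y q = (x - y) p + y (p - q)\<close>.\<close>
  have "(x \<ominus> y) \<otimes> ?p \<in> ideal_power A I (2 + length xs)"
    using Cons(1) list_prod_in_ideal_power[OF sub(1)] by (intro mult_in_ideal_power) simp_all
  moreover have "y \<otimes> (?p \<ominus> ?q) \<in> ideal_power A I (Suc 0 + Suc (length xs))"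
    using Cons(1,3) ideal_power_1 by (intro mult_in_ideal_power) simp_all
  ultimately have "(x \<ominus> y) \<otimes> ?p \<oplus> y \<otimes> (?p \<ominus> ?q) \<in> ideal_power A I (Suc (Suc (length xs)))"
    using additive_subgroup.a_closed[OF ideal.axioms(1)[OF ideal_ideal_power[of "Suc (Suc (length xs))"]]]
    by simp
  moreover have "(x \<ominus> y) \<otimes> ?p \<oplus> y \<otimes> (?p \<ominus> ?q) = x \<otimes> ?p \<ominus> y \<otimes> ?q"
    using carr by algebra
  ultimately show ?case by simp
qed

end

section \<open>The cotangent space\<close>

context algebra_ideal
begin

abbreviation cotangent_class :: "'a \<Rightarrow> 'a set" where
  "cotangent_class x \<equiv> ideal_power A I 2 +> x"

lemma algebra_ideal_power: "algebra_ideal A (ideal_power A I k)"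
  by (intro algebra_ideal.intro ideal_ideal_power algebra.algebra_axioms)

lemma cotangent_class_eq_iff:
  "x \<in> carrier A \<Longrightarrow> y \<in> carrier A \<Longrightarrow>
    cotangent_class x = cotangent_class y \<longleftrightarrow> x \<ominus> y \<in> ideal_power A I 2"
  by (rule algebra_ideal.coset_eq_iff[OF algebra_ideal_power])

lemma carrier_cotangent_space: "carrier (cotangent_space A I) = cotangent_class ` I"
  by (auto simp: cotangent_space_def)

lemma class_in_carrier: "x \<in> I \<Longrightarrow> cotangent_class x \<in> carrier (cotangent_space A I)"
  by (simp add: carrier_cotangent_space)

lemma cotangent_submodule:
  "LinearCombinations.submodule complex_field (cotangent_class ` I) (alg_quot A (ideal_power A I 2))"
proof -
  interpret J: algebra_ideal A "ideal_power A I 2" by (rule algebra_ideal_power)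
  interpret Q: Module.algebra complex_field "alg_quot A (ideal_power A I 2)"
    by (rule J.algebra_alg_quot)
  interpret mod_hom complex_field A "alg_quot A (ideal_power A I 2)" cotangent_class
    using J.coset_module_hom algebra.module Q.module
    by (intro mod_hom.intro mod_hom_axioms.intro)
  show ?thesis
  proof (rule submodule.intro[OF Q.module], goal_cases)
    case 1 show ?case using a_subset by auto
  next
    case (2 v w)
    then obtain x y where "x \<in> I" "y \<in> I" "v = cotangent_class x" "w = cotangent_class y" by blast
    then show ?case using f_add[of x y] a_Hcarr by (auto intro!: image_eqI[of _ _ "x \<oplus> y"] a_closed)
  next
    case 3
    show ?case using f0_is_0 by (intro image_eqI[of _ _ \<zero>]) simp_all
  next
    case (4 c v)
    then obtain x where "x \<in> I" "v = cotangent_class x" by blast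
    then show ?case using f_smult[of c x] a_Hcarr by (auto intro!: image_eqI[of _ _ "c \<odot> x"] smult_in_ideal)
  qed
qed

lemma vectorspace_cotangent_space: "vectorspace complex_field (cotangent_space A I)"
proof -
  have "{cotangent_class x | x. x \<in> I} = cotangent_class ` I" by blast
  then show ?thesis
    using vectorspace_subspace_of[OF Module.algebra.module cotangent_submodule]
      algebra_ideal.algebra_alg_quot[OF algebra_ideal_power]
    unfolding cotangent_space_def by simp
qed

text \<open>The finite sum on the left is formed in \<open>I/I\<^sup>2\<close>, the one on the right in \<open>A\<close>: linear algebra in the
  cotangent space is done with representatives modulo \<open>I\<^sup>2\<close>.\<close>

lemma cotangent_class_linear_combination:
  assumes "finite S" "\<And>i. i \<in> S \<Longrightarrow> x i \<in> I"
  shows "(\<Oplus>\<^bsub>cotangent_space A I\<^esub>i\<in>S. c i \<odot>\<^bsub>cotangent_space A I\<^esub> cotangent_class (x i)) =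
    cotangent_class (\<Oplus>i\<in>S. c i \<odot> x i)"
proof -
  let ?Q = "alg_quot A (ideal_power A I 2)"
  interpret J: algebra_ideal A "ideal_power A I 2" by (rule algebra_ideal_power)
  interpret Q: Module.algebra complex_field ?Q
    by (rule J.algebra_alg_quot)
  interpret mod_hom complex_field A ?Q cotangent_class
    using J.coset_module_hom algebra.module Q.module
    by (intro mod_hom.intro mod_hom_axioms.intro)
  interpret cot: vectorspace complex_field "cotangent_space A I" by (rule vectorspace_cotangent_space)
  have ops: "\<zero>\<^bsub>cotangent_space A I\<^esub> = \<zero>\<^bsub>?Q\<^esub>" "(\<oplus>\<^bsub>cotangent_space A I\<^esub>) = (\<oplus>\<^bsub>?Q\<^esub>)"
    "(\<odot>\<^bsub>cotangent_space A I\<^esub>) = (\<odot>\<^bsub>?Q\<^esub>)"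
    by (simp_all add: cotangent_space_def)
  show ?thesis
    using assms
  proof (induction S rule: finite_induct)
    case empty
    show ?case using f0_is_0 by (simp add: ops)
  next
    case (insert j S)
    have x: "x i \<in> carrier A" if "i \<in> insert j S" for i using insert.prems that a_Hcarr by blast
    then have fin: "(\<Oplus>i\<in>S. c i \<odot> x i) \<in> carrier A" by (intro finsum_closed) (auto simp: Pi_def)
    have cl: "cotangent_class (x i) \<in> carrier (cotangent_space A I)" if "i \<in> insert j S" for i
      using insert.prems that by (auto simp: carrier_cotangent_space)
    have "(\<Oplus>\<^bsub>cotangent_space A I\<^esub>i\<in>insert j S. c i \<odot>\<^bsub>cotangent_space A I\<^esub> cotangent_class (x i)) =
      c j \<odot>\<^bsub>?Q\<^esub> cotangent_class (x j) \<oplus>\<^bsub>?Q\<^esub> cotangent_class (\<Oplus>i\<in>S. c i \<odot> x i)"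
      using insert cl by (subst cot.M.finsum_insert) (auto simp: Pi_def ops(2) ops(3)[symmetric])
    also have "\<dots> = cotangent_class (c j \<odot> x j \<oplus> (\<Oplus>i\<in>S. c i \<odot> x i))"
      using x fin by (simp add: f_add[symmetric] f_smult[symmetric] del: f_add f_smult)
    also have "c j \<odot> x j \<oplus> (\<Oplus>i\<in>S. c i \<odot> x i) = (\<Oplus>i\<in>insert j S. c i \<odot> x i)"
      using insert x by (subst finsum_insert) (auto simp: Pi_def)
    finally show ?case .
  qed
qed

abbreviation lifts :: "nat \<Rightarrow> (nat \<Rightarrow> 'a) \<Rightarrow> (nat \<Rightarrow> 'a set) \<Rightarrow> bool" where
  "lifts r x e \<equiv> \<forall>i<r. x i \<in> I \<and> e i = cotangent_class (x i)"

lemma ordered_basis_lift: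
  assumes "ordered_basis (cotangent_space A I) r e"
  obtains x where "lifts r x e"
proof -
  interpret cot: vectorspace complex_field "cotangent_space A I" by (rule vectorspace_cotangent_space)
  have e: "e ` {..<r} \<subseteq> cotangent_class ` I"
    using assms by (simp add: ordered_basis_def cot.basis_def carrier_cotangent_space)
  have "\<forall>i\<in>{..<r}. \<exists>x. x \<in> I \<and> e i = cotangent_class x"
  proof
    fix i assume "i \<in> {..<r}"
    then have "e i \<in> cotangent_class ` I" using e by blast
    then show "\<exists>x. x \<in> I \<and> e i = cotangent_class x" by blast
  qed
  from bchoice[OF this] show ?thesis using that by auto
qed

lemma linear_combination_in_ideal:
  "(\<And>i. i \<in> S \<Longrightarrow> x i \<in> I) \<Longrightarrow> (\<Oplus>i\<in>S. c i \<odot> x i) \<in> I"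
proof (induction S rule: infinite_finite_induct)
  case (insert j S)
  then have "(\<Oplus>i\<in>insert j S. c i \<odot> x i) = c j \<odot> x j \<oplus> (\<Oplus>i\<in>S. c i \<odot> x i)"
    using a_Hcarr by (subst finsum_insert) (auto simp: Pi_def)
  then show ?case using insert by (auto intro!: a_closed smult_in_ideal)
qed simp_all

lemma cotangent_coordinates:
  assumes "ordered_basis (cotangent_space A I) r e"
    and "lifts r x e"
    and "y \<in> I"
  obtains c where "cotangent_class y = cotangent_class (\<Oplus>i\<in>{..<r}. c i \<odot> x i)"
proof -
  have "cotangent_class y \<in> carrier (cotangent_space A I)"
    using assms(3) by (simp add: carrier_cotangent_space)
  then obtain c where c: "cotangent_class y =
      (\<Oplus>\<^bsub>cotangent_space A I\<^esub>i\<in>{..<r}. c i \<odot>\<^bsub>cotangent_space A I\<^esub> e i)"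
    using ordered_basis_coordinates[OF vectorspace_cotangent_space assms(1)] by blast
  interpret cot: vectorspace complex_field "cotangent_space A I" by (rule vectorspace_cotangent_space)
  have "(\<Oplus>\<^bsub>cotangent_space A I\<^esub>i\<in>{..<r}. c i \<odot>\<^bsub>cotangent_space A I\<^esub> e i) =
      (\<Oplus>\<^bsub>cotangent_space A I\<^esub>i\<in>{..<r}. c i \<odot>\<^bsub>cotangent_space A I\<^esub> cotangent_class (x i))"
    using assms(2) by (intro cot.M.finsum_cong') (auto simp: Pi_def class_in_carrier intro!: cot.smult_closed)
  also have "\<dots> = cotangent_class (\<Oplus>i\<in>{..<r}. c i \<odot> x i)"
    using assms(2) by (intro cotangent_class_linear_combination) auto
  finally show ?thesis using c that by simp
qed

lemma cotangent_coordinates_unique: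
  assumes "ordered_basis (cotangent_space A I) r e"
    and "lifts r x e"
    and "cotangent_class (\<Oplus>i\<in>{..<r}. c i \<odot> x i) = cotangent_class (\<Oplus>i\<in>{..<r}. d i \<odot> x i)"
    and "i < r"
  shows "c i = d i"
proof -
  interpret cot: vectorspace complex_field "cotangent_space A I" by (rule vectorspace_cotangent_space)
  have "(\<Oplus>\<^bsub>cotangent_space A I\<^esub>i\<in>{..<r}. c i \<odot>\<^bsub>cotangent_space A I\<^esub> e i) =
      cotangent_class (\<Oplus>i\<in>{..<r}. c i \<odot> x i)" for c
  proof -
    have "(\<Oplus>\<^bsub>cotangent_space A I\<^esub>i\<in>{..<r}. c i \<odot>\<^bsub>cotangent_space A I\<^esub> e i) =
        (\<Oplus>\<^bsub>cotangent_space A I\<^esub>i\<in>{..<r}. c i \<odot>\<^bsub>cotangent_space A I\<^esub> cotangent_class (x i))"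
      using assms(2) by (intro cot.M.finsum_cong') (auto simp: Pi_def class_in_carrier intro!: cot.smult_closed)
    also have "\<dots> = cotangent_class (\<Oplus>i\<in>{..<r}. c i \<odot> x i)"
      using assms(2) by (intro cotangent_class_linear_combination) auto
    finally show ?thesis .
  qed
  then show ?thesis
    using ordered_basis_coordinates_unique[OF vectorspace_cotangent_space assms(1) _ assms(4), of c d] assms(3)
    by simp
qed

end

section \<open>Products of linear combinations\<close>

lemma tensor_indices_0: "tensor_indices r 0 = {[]}"
  by (auto simp: tensor_indices_def)

lemma tensor_indices_Suc:
  "tensor_indices r (Suc n) = (\<Union>i\<in>{..<r}. (#) i ` tensor_indices r n)"
  by (auto simp: tensor_indices_def length_Suc_conv)

lemma finite_tensor_indices: "finite (tensor_indices r n)"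
  using finite_lists_length_eq[of "{..<r}" n] by (simp add: tensor_indices_def conj_commute)

context algebra_ideal
begin

text \<open>Multilinearity: a product of linear combinations is the sum over all ways to choose one term from
  each factor.\<close>

lemma list_prod_expand:
  assumes x: "\<And>i. i < r \<Longrightarrow> x i \<in> carrier A"
  shows "foldr (\<otimes>) (map (\<lambda>j. \<Oplus>i\<in>{..<r}. g i j \<odot> x i) js) \<one> =
    (\<Oplus>is\<in>tensor_indices r (length js).
      (\<Prod>k<length js. g (is ! k) (js ! k)) \<odot> foldr (\<otimes>) (map x is) \<one>)"
proof (induction js)
  case Nil
  show ?case using algebra.smult_one[of "\<one>"] by (simp add: tensor_indices_0)
next
  case (Cons j js)
  let ?n = "length js"
  let ?T = "tensor_indices r ?n"
  let ?c = "\<lambda>js is. \<Prod>k<length js. g (is ! k) (js ! k)"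
  let ?p = "\<lambda>is. foldr (\<otimes>) (map x is) \<one>"
  have p: "?p is \<in> carrier A" if "is \<in> tensor_indices r m" for "is" m
    using that x by (intro list_prod_closed) (auto simp: tensor_indices_def)
  have c: "?c (j # js) (i # is) = g i j * ?c js is" for i "is"
    by (simp add: prod.lessThan_Suc_shift del: prod.lessThan_Suc)
  have fin: "(\<Oplus>is\<in>?T. ?c js is \<odot> ?p is) \<in> carrier A"
    using p by (intro finsum_closed) auto
  have "(\<Oplus>is\<in>tensor_indices r (length (j # js)). ?c (j # js) is \<odot> ?p is) =
      (\<Oplus>i\<in>{..<r}. \<Oplus>is\<in>(#) i ` ?T. ?c (j # js) is \<odot> ?p is)"
    unfolding list.size add_Suc_right add_0_right tensor_indices_Suc
  proof (rule add.finprod_UN_disjoint, goal_cases)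
    case (4 i "is")
    then have "?p is \<in> carrier A" using p[of "is" "Suc ?n"] by (auto simp: tensor_indices_Suc)
    then show ?case by simp
  qed (auto simp: finite_tensor_indices pairwise_def disjnt_def)
  also have "\<dots> = (\<Oplus>i\<in>{..<r}. (g i j \<odot> x i) \<otimes> (\<Oplus>is\<in>?T. ?c js is \<odot> ?p is))"
  proof (intro add.finprod_cong' refl)
    fix i assume "i \<in> {..<r}"
    then have xi: "x i \<in> carrier A" using x by simp
    have "(\<Oplus>is\<in>(#) i ` ?T. ?c (j # js) is \<odot> ?p is) = (\<Oplus>is\<in>?T. ?c (j # js) (i # is) \<odot> ?p (i # is))"
      using p xi by (intro add.finprod_reindex) auto
    also have "\<dots> = (\<Oplus>is\<in>?T. (g i j \<odot> x i) \<otimes> (?c js is \<odot> ?p is))"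
    proof (intro add.finprod_cong' refl)
      fix "is" assume "is \<in> ?T"
      then have pi: "?p is \<in> carrier A" using p by blast
      have "(g i j \<odot> x i) \<otimes> (?c js is \<odot> ?p is) = ?c js is \<odot> (g i j \<odot> (x i \<otimes> ?p is))"
        using xi pi by (simp add: algebra.smult_assoc2 mult_smult)
      also have "\<dots> = (g i j * ?c js is) \<odot> (x i \<otimes> ?p is)"
        using xi pi algebra.smult_assoc1[of "?c js is" "g i j" "x i \<otimes> ?p is"] by (simp add: mult.commute)
      finally show "?c (j # js) (i # is) \<odot> ?p (i # is) = (g i j \<odot> x i) \<otimes> (?c js is \<odot> ?p is)"
        by (simp only: c list.map foldr.simps o_def)
    qed (use p xi in auto)
    also have "\<dots> = (g i j \<odot> x i) \<otimes> (\<Oplus>is\<in>?T. ?c js is \<odot> ?p is)"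
      using p xi by (intro finsum_rdistr[symmetric] finite_tensor_indices) auto
    finally show "(\<Oplus>is\<in>(#) i ` ?T. ?c (j # js) is \<odot> ?p is) = (g i j \<odot> x i) \<otimes> (\<Oplus>is\<in>?T. ?c js is \<odot> ?p is)" .
  qed (use fin x in auto)
  also have "\<dots> = (\<Oplus>i\<in>{..<r}. g i j \<odot> x i) \<otimes> (\<Oplus>is\<in>?T. ?c js is \<odot> ?p is)"
    using fin x by (intro finsum_ldistr[symmetric]) auto
  finally show ?case
    using Cons.IH by simp
qed

lemma smult_sum:
  assumes "finite S" "x \<in> carrier A"
  shows "(\<Oplus>i\<in>S. c i \<odot> x) = (\<Sum>i\<in>S. c i) \<odot> x"
  using assms
proof (induction S rule: finite_induct)
  case empty
  then show ?case using algebra.smult_l_null[of x] by simp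
next
  case (insert j S)
  have "(\<Oplus>i\<in>insert j S. c i \<odot> x) = c j \<odot> x \<oplus> (\<Oplus>i\<in>S. c i \<odot> x)"
    using insert by (subst finsum_insert) auto
  then show ?case
    using insert algebra.smult_l_distr[of "c j" "\<Sum>i\<in>S. c i" x] by simp
qed

text \<open>Composition of substitutions is the matrix product.\<close>

lemma linear_combination_compose:
  fixes r :: nat
  assumes "finite S" "\<And>i. i < r \<Longrightarrow> x i \<in> carrier A"
  shows "(\<Oplus>j\<in>S. b j \<odot> (\<Oplus>i\<in>{..<r}. h i j \<odot> x i)) = (\<Oplus>i\<in>{..<r}. (\<Sum>j\<in>S. h i j * b j) \<odot> x i)"
proof -
  have "(\<Oplus>j\<in>S. b j \<odot> (\<Oplus>i\<in>{..<r}. h i j \<odot> x i)) = (\<Oplus>j\<in>S. \<Oplus>i\<in>{..<r}. (h i j * b j) \<odot> x i)"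
  proof (intro add.finprod_cong' refl)
    fix j assume "j \<in> S"
    have "b j \<odot> (\<Oplus>i\<in>{..<r}. h i j \<odot> x i) = (\<Oplus>i\<in>{..<r}. b j \<odot> (h i j \<odot> x i))"
      using assms(2) by (intro algebra.finsum_smult_ldistr) auto
    also have "\<dots> = (\<Oplus>i\<in>{..<r}. (h i j * b j) \<odot> x i)"
      using assms(2) algebra.smult_assoc1[of "b j" "h i j" "x i" for i]
      by (intro add.finprod_cong' refl) (auto simp: mult.commute)
    finally show "b j \<odot> (\<Oplus>i\<in>{..<r}. h i j \<odot> x i) = (\<Oplus>i\<in>{..<r}. (h i j * b j) \<odot> x i)" .
  qed (use assms(2) in \<open>auto intro!: finsum_closed\<close>)
  also have "\<dots> = (\<Oplus>i\<in>{..<r}. (\<Sum>j\<in>S. h i j * b j) \<odot> x i)"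
    using assms(1)
  proof (induction S rule: finite_induct)
    case empty
    have "(\<Oplus>i\<in>{..<r}. (\<Sum>j\<in>{}. h i j * b j) \<odot> x i) = (\<Oplus>i\<in>{..<r}. \<zero>)"
      using assms(2) algebra.smult_l_null by (intro add.finprod_cong' refl) auto
    then show ?case by simp
  next
    case (insert k S)
    have "(\<Oplus>j\<in>insert k S. \<Oplus>i\<in>{..<r}. (h i j * b j) \<odot> x i) =
      (\<Oplus>i\<in>{..<r}. (h i k * b k) \<odot> x i) \<oplus> (\<Oplus>i\<in>{..<r}. (\<Sum>j\<in>S. h i j * b j) \<odot> x i)"
      using insert assms(2) by (subst finsum_insert) (auto intro!: finsum_closed)
    also have "\<dots> = (\<Oplus>i\<in>{..<r}. (h i k * b k) \<odot> x i \<oplus> (\<Sum>j\<in>S. h i j * b j) \<odot> x i)"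
      using assms(2) by (intro finsum_addf[symmetric]) auto
    also have "\<dots> = (\<Oplus>i\<in>{..<r}. (\<Sum>j\<in>insert k S. h i j * b j) \<odot> x i)"
      using insert assms(2) algebra.smult_l_distr[of "h i k * b k" "\<Sum>j\<in>S. h i j * b j" "x i" for i]
      by (intro add.finprod_cong' refl) auto
    finally show ?case .
  qed
  finally show ?thesis .
qed

end

section \<open>The multiplication tensor of a nilpotent ideal\<close>

text \<open>The algebras of the theorem: the ideal is the maximal ideal, whose power \<open>N + 1\<close> vanishes.\<close>

locale nilpotent_ideal = algebra_ideal +
  fixes N :: nat
  assumes power_Suc_zero: "ideal_power A I (N + 1) = {\<zero>}"
begin

text \<open>The product of residue classes is defined by a description that demands independence of the
  representatives. Independence holds because congruent factors change the product only by an element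
  of the vanishing power \<open>N + 1\<close>.\<close>

lemma class_product_eq:
  assumes "set xs \<subseteq> I" "length xs = N"
  shows "class_product A (map cotangent_class xs) = foldr (\<otimes>) xs \<one>"
  unfolding class_product_def
proof (rule the_equality)
  show "\<forall>ys. list_all2 (\<in>) ys (map cotangent_class xs) \<longrightarrow> foldr (\<otimes>) ys \<one> = foldr (\<otimes>) xs \<one>"
  proof (intro allI impI)
    interpret J: algebra_ideal A "ideal_power A I 2" by (rule algebra_ideal_power)
    fix ys assume ys: "list_all2 (\<in>) ys (map cotangent_class xs)"
    have nth: "xs ! i \<in> I" if "i < length xs" for i
      using assms(1) that by (meson nth_mem subsetD)
    have rep: "y \<in> I \<and> x \<in> I \<and> y \<ominus> x \<in> ideal_power A I 2"
      if x: "x \<in> I" and y: "y \<in> cotangent_class x" for x y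
    proof -
      obtain h where h: "h \<in> ideal_power A I 2" "y = h \<oplus> x"
        using y by (auto simp: a_r_coset_def')
      have "ideal_power A I 2 \<subseteq> I"
        using ideal_prod_inter[OF ideal_axioms ideal_axioms] ideal_power_Suc[of "Suc 0"] ideal_power_1
        by (simp add: numeral_2_eq_2)
      then have "y \<in> I" using h x by (auto intro: a_closed)
      moreover have "y \<ominus> x = h" using h x a_Hcarr J.a_Hcarr by (simp add: minus_eq a_assoc r_neg)
      ultimately show ?thesis using h x by simp
    qed
    have "list_all2 (\<lambda>y x. y \<in> I \<and> x \<in> I \<and> y \<ominus> x \<in> ideal_power A I 2) ys xs"
    proof (rule list_all2_all_nthI)
      show "length ys = length xs" using ys by (auto dest: list_all2_lengthD)
    next
      fix i assume "i < length ys"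
      then show "ys ! i \<in> I \<and> xs ! i \<in> I \<and> ys ! i \<ominus> xs ! i \<in> ideal_power A I 2"
        using ys by (intro rep nth) (auto simp: list_all2_conv_all_nth)
    qed
    moreover from this have "set ys \<subseteq> I" by (auto simp: list_all2_conv_all_nth in_set_conv_nth)
    moreover have "length ys = N" using ys assms(2) by (auto dest: list_all2_lengthD)
    ultimately have "foldr (\<otimes>) ys \<one> \<ominus> foldr (\<otimes>) xs \<one> = \<zero>"
      using list_prod_congruent[of ys xs] power_Suc_zero by simp
    then show "foldr (\<otimes>) ys \<one> = foldr (\<otimes>) xs \<one>"
      using \<open>set ys \<subseteq> I\<close> assms(1) a_subset list_prod_closed[of ys] list_prod_closed[of xs] by auto
  qed
next
  fix p assume "\<forall>ys. list_all2 (\<in>) ys (map cotangent_class xs) \<longrightarrow> foldr (\<otimes>) ys \<one> = p"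
  moreover have "list_all2 (\<in>) xs (map cotangent_class xs)"
  proof (rule list_all2_all_nthI)
    interpret J: algebra_ideal A "ideal_power A I 2" by (rule algebra_ideal_power)
    fix i assume "i < length xs"
    then have "xs ! i \<in> carrier A" using assms(1) a_subset nth_mem[of i xs] by blast
    then show "xs ! i \<in> map cotangent_class xs ! i"
      using \<open>i < length xs\<close> J.a_rcos_self by simp
  qed simp
  ultimately show "p = foldr (\<otimes>) xs \<one>" by blast
qed

context
  fixes w
  assumes w: "vectorspace.basis complex_field (subspace_of A (ideal_power A I N)) {w}"
begin

lemma vectorspace_top_power: "vectorspace complex_field (subspace_of A (ideal_power A I N))"
  using algebra.module algebra_ideal.submodule_ideal[OF algebra_ideal_power] by (rule vectorspace_subspace_of)

lemma top_power_generator_closed: "w \<in> ideal_power A I N" "w \<in> carrier A"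
proof -
  interpret W: vectorspace complex_field "subspace_of A (ideal_power A I N)" by (rule vectorspace_top_power)
  show "w \<in> ideal_power A I N" using w by (simp add: W.basis_def)
  then show "w \<in> carrier A" using ideal_power_subset by blast
qed

lemma top_power_sum_singleton:
  "(\<Oplus>\<^bsub>subspace_of A (ideal_power A I N)\<^esub>i\<in>{..<Suc 0}. c i \<odot>\<^bsub>subspace_of A (ideal_power A I N)\<^esub> w) = c 0 \<odot> w"
proof -
  interpret W: vectorspace complex_field "subspace_of A (ideal_power A I N)" by (rule vectorspace_top_power)
  have "c 0 \<odot> w \<in> ideal_power A I N"
    using top_power_generator_closed algebra_ideal.smult_in_ideal[OF algebra_ideal_power] by blast
  then show ?thesis
    using top_power_generator_closed by (simp add: lessThan_Suc W.M.finsum_insert)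
qed

lemma top_power_coordinate:
  assumes "v \<in> ideal_power A I N"
  obtains c where "v = c \<odot> w"
proof -
  have "v \<in> carrier (subspace_of A (ideal_power A I N))" using assms by simp
  then obtain c where "v = (\<Oplus>\<^bsub>subspace_of A (ideal_power A I N)\<^esub>i\<in>{..<Suc 0}.
      c i \<odot>\<^bsub>subspace_of A (ideal_power A I N)\<^esub> w)"
    by (rule ordered_basis_coordinates[OF vectorspace_top_power ordered_basis_singleton[THEN iffD2, OF w]])
  then show ?thesis unfolding top_power_sum_singleton by (rule that)
qed

lemma top_power_coordinate_unique: "c \<odot> w = d \<odot> w \<Longrightarrow> c = d"
  using ordered_basis_coordinates_unique[OF vectorspace_top_power ordered_basis_singleton[THEN iffD2, OF w], of "\<lambda>_. c" "\<lambda>_. d" 0]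
    top_power_sum_singleton[of "\<lambda>_. c"] top_power_sum_singleton[of "\<lambda>_. d"] by simp

text \<open>The coefficients of the tensor are read off from products of representatives; uniqueness of the
  coordinate with respect to \<open>w\<close> resolves the description in the definition of the tensor.\<close>

lemma mult_tensor_eqI:
  assumes x: "lifts r x e"
    and js: "js \<in> tensor_indices r N"
    and c: "foldr (\<otimes>) (map x js) \<one> = c \<odot> w"
  shows "mult_tensor A e w js = c"
proof -
  have classes: "map e js = map cotangent_class (map x js)"
    using x js by (auto simp: tensor_indices_def)
  have "set (map x js) \<subseteq> I" "length (map x js) = N"
    using x js by (auto simp: tensor_indices_def subset_iff)
  then have "class_product A (map e js) = c \<odot> w"
    unfolding classes c[symmetric] by (rule class_product_eq)
  then show ?thesis
    using top_power_coordinate_unique by (auto simp: mult_tensor_def)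
qed

lemma mult_tensor_eq:
  assumes x: "lifts r x e"
    and js: "js \<in> tensor_indices r N"
  shows "foldr (\<otimes>) (map x js) \<one> = mult_tensor A e w js \<odot> w"
proof -
  have "foldr (\<otimes>) (map x js) \<one> \<in> ideal_power A I N"
    using list_prod_in_ideal_power[of "map x js"] x js by (auto simp: tensor_indices_def)
  then obtain c where "foldr (\<otimes>) (map x js) \<one> = c \<odot> w" by (rule top_power_coordinate)
  then show ?thesis using mult_tensor_eqI[OF x js] by simp
qed

lemma mult_tensor_symmetric:
  assumes "ordered_basis (cotangent_space A I) r e"
  shows "mult_tensor A e w \<in> sym_tensors r N"
  unfolding sym_tensors_def
proof (intro CollectI ballI impI)
  fix "is" js assume I: "is \<in> tensor_indices r N" "js \<in> tensor_indices r N" "mset is = mset js"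
  obtain x where x: "lifts r x e"
    by (rule ordered_basis_lift[OF assms])
  have "foldr (\<otimes>) (map x is) \<one> = foldr (\<otimes>) (map x js) \<one>"
    using I x a_Hcarr by (intro algebra.multlist_perm_cong) (auto simp: tensor_indices_def)
  then show "mult_tensor A e w is = mult_tensor A e w js"
    using mult_tensor_eq[OF x] I(1,2) top_power_coordinate_unique by simp
qed

end

text \<open>The columns of the matrix are the coordinates of the classes of the \<open>y j\<close>.\<close>

lemma cotangent_coordinate_matrix:
  assumes "ordered_basis (cotangent_space A I) r e"
    and "lifts r x e"
    and "\<forall>j<r. y j \<in> I"
  obtains g where "\<forall>j<r. cotangent_class (y j) = cotangent_class (\<Oplus>i\<in>{..<r}. g i j \<odot> x i)"
proof -
  have "\<exists>c. j < r \<longrightarrow> cotangent_class (y j) = cotangent_class (\<Oplus>i\<in>{..<r}. c i \<odot> x i)" for j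
  proof (cases "j < r")
    case True
    obtain c where "cotangent_class (y j) = cotangent_class (\<Oplus>i\<in>{..<r}. c i \<odot> x i)"
      using cotangent_coordinates[OF assms(1,2), of "y j"] assms(3) True by blast
    then show ?thesis by blast
  qed simp
  then have "\<forall>j. \<exists>c. j < r \<longrightarrow> cotangent_class (y j) = cotangent_class (\<Oplus>i\<in>{..<r}. c i \<odot> x i)" by blast
  from choice[OF this] obtain c where
    "\<forall>j. j < r \<longrightarrow> cotangent_class (y j) = cotangent_class (\<Oplus>i\<in>{..<r}. c j i \<odot> x i)" by blast
  then show ?thesis using that[of "\<lambda>i j. c j i"] by blast
qed

text \<open>The transition matrix \<open>g\<close> is invertible because expressing each basis through the other and
  comparing coordinates gives a left inverse \<open>h\<close>. Passing from \<open>w\<close> to \<open>w'\<close> contributes the scalar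
  \<open>c\<close>.\<close>

lemma mult_tensor_change_of_basis:
  assumes e: "ordered_basis (cotangent_space A I) r e" and e': "ordered_basis (cotangent_space A I) r e'"
    and w: "vectorspace.basis complex_field (subspace_of A (ideal_power A I N)) {w}"
    and w': "vectorspace.basis complex_field (subspace_of A (ideal_power A I N)) {w'}"
  obtains g c where "g \<in> carrier_mat r r" "Determinant.det g \<noteq> 0" "c \<noteq> 0"
    "\<And>js. js \<in> tensor_indices r N \<Longrightarrow>
      mult_tensor A e' w' js = c * tensor_act r N g (mult_tensor A e w) js"
proof -
  obtain x where x: "lifts r x e"
    by (rule ordered_basis_lift[OF e])
  obtain x' where x': "lifts r x' e'"
    by (rule ordered_basis_lift[OF e'])
  obtain g where "\<forall>j<r. cotangent_class (x' j) = cotangent_class (\<Oplus>i\<in>{..<r}. g i j \<odot> x i)"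
    by (rule cotangent_coordinate_matrix[OF e x, of x']) (use x' in auto)
  then have g: "e' j = cotangent_class (\<Oplus>i\<in>{..<r}. g i j \<odot> x i)" if "j < r" for j
    using x' that by simp
  obtain h where "\<forall>j<r. cotangent_class (x j) = cotangent_class (\<Oplus>i\<in>{..<r}. h i j \<odot> x' i)"
    by (rule cotangent_coordinate_matrix[OF e' x', of x]) (use x in auto)
  then have h: "e j = cotangent_class (\<Oplus>i\<in>{..<r}. h i j \<odot> x' i)" if "j < r" for j
    using x that by simp
  define y where "y j = (\<Oplus>i\<in>{..<r}. g i j \<odot> x i)" for j
  define z where "z j = (\<Oplus>i\<in>{..<r}. h i j \<odot> x' i)" for j
  have y: "y j \<in> I" and z: "z j \<in> I" for j
    unfolding y_def z_def using x x' by (auto intro!: linear_combination_in_ideal)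
  have ey: "e' j = cotangent_class (y j)" if "j < r" for j
    using g[OF that] by (simp add: y_def)
  \<comment> \<open>Substitute \<open>x j = \<Sum>\<^sub>i h i j x' i\<close> into \<open>x' k = \<Sum>\<^sub>j g j k x j\<close>, both modulo \<open>I\<^sup>2\<close>, and compare
    coordinates.\<close>
  have inverse: "(\<Sum>j<r. h i j * g j k) = (if i = k then 1 else 0)" if "i < r" "k < r" for i k
  proof -
    interpret cot: vectorspace complex_field "cotangent_space A I" by (rule vectorspace_cotangent_space)
    have "cotangent_class (y k) =
        (\<Oplus>\<^bsub>cotangent_space A I\<^esub>j\<in>{..<r}. g j k \<odot>\<^bsub>cotangent_space A I\<^esub> cotangent_class (x j))"
      unfolding y_def using x by (intro cotangent_class_linear_combination[symmetric]) auto
    also have "\<dots> =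
        (\<Oplus>\<^bsub>cotangent_space A I\<^esub>j\<in>{..<r}. g j k \<odot>\<^bsub>cotangent_space A I\<^esub> cotangent_class (z j))"
      using x h z by (intro cot.M.finsum_cong') (auto simp: Pi_def z_def[symmetric] class_in_carrier intro!: cot.smult_closed)
    also have "\<dots> = cotangent_class (\<Oplus>j\<in>{..<r}. g j k \<odot> z j)"
      using z by (intro cotangent_class_linear_combination) auto
    also have "(\<Oplus>j\<in>{..<r}. g j k \<odot> z j) = (\<Oplus>i\<in>{..<r}. (\<Sum>j<r. h i j * g j k) \<odot> x' i)"
      unfolding z_def using x' a_Hcarr by (intro linear_combination_compose) auto
    finally have "cotangent_class (\<Oplus>i\<in>{..<r}. (\<Sum>j<r. h i j * g j k) \<odot> x' i) = cotangent_class (x' k)"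
      using ey x' that(2) by simp
    also have "x' k = (\<Oplus>i\<in>{..<r}. (if i = k then 1 else 0) \<odot> x' i)"
    proof -
      have "(\<Oplus>i\<in>{..<r}. (if i = k then 1 else 0) \<odot> x' i) = (\<Oplus>i\<in>{..<r}. if k = i then x' i else \<zero>)"
        using x' a_Hcarr algebra.smult_l_null algebra.smult_one
        by (intro add.finprod_cong' refl) auto
      also have "\<dots> = x' k"
        using x' a_Hcarr that(2) by (intro add.finprod_singleton) auto
      finally show ?thesis by simp
    qed
    finally show ?thesis
      by (rule cotangent_coordinates_unique[OF e' x' _ that(1),
            of "\<lambda>i. \<Sum>j<r. h i j * g j k" "\<lambda>i. if i = k then 1 else 0"])
  qed
  define G where "G = mat r r (\<lambda>(i, j). g i j)"
  define H where "H = mat r r (\<lambda>(i, j). h i j)"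
  have carrier: "G \<in> carrier_mat r r" "H \<in> carrier_mat r r" by (simp_all add: G_def H_def)
  have "H * G = 1\<^sub>m r"
    by (rule eq_matI) (use inverse in \<open>auto simp: G_def H_def scalar_prod_def lessThan_atLeast0\<close>)
  then have "Determinant.det H * Determinant.det G = 1"
    using det_mult[OF carrier(2,1)] by simp
  then have det: "Determinant.det G \<noteq> 0" by auto
  obtain c where c: "w = c \<odot> w'"
    using top_power_coordinate[OF w' top_power_generator_closed(1)[OF w]] .
  have wc: "w \<in> carrier A" "w' \<in> carrier A"
    using top_power_generator_closed(2) w w' by auto
  \<comment> \<open>Otherwise \<open>w = 0\<close>, and the coordinate of \<open>0\<close> with respect to \<open>w\<close> would not be unique.\<close>
  have "c \<noteq> 0"
  proof
    assume "c = 0"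
    then have "1 \<odot> w = 0 \<odot> w"
      using c wc algebra.smult_l_null[of w] algebra.smult_l_null[of w'] algebra.smult_one[of w] by simp
    then show False using top_power_coordinate_unique[OF w] by fastforce
  qed
  have "mult_tensor A e' w' js = c * tensor_act r N G (mult_tensor A e w) js"
    if js: "js \<in> tensor_indices r N" for js
  proof (rule mult_tensor_eqI[OF w' _ js, of y])
    show "lifts r y e'" using y ey by blast
    let ?a = "mult_tensor A e w"
    have len: "length js = N" using js by (simp add: tensor_indices_def)
    have "foldr (\<otimes>) (map y js) \<one> =
      (\<Oplus>is\<in>tensor_indices r N. (\<Prod>k<N. g (is ! k) (js ! k)) \<odot> foldr (\<otimes>) (map x is) \<one>)"
      unfolding y_def using list_prod_expand[of r x g js] x a_Hcarr len by simp
    also have "\<dots> = (\<Oplus>is\<in>tensor_indices r N. ((\<Prod>k<N. G $$ (is ! k, js ! k)) * ?a is) \<odot> w)"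
    proof (intro add.finprod_cong' refl)
      fix "is" assume I: "is \<in> tensor_indices r N"
      have "(\<Prod>k<N. g (is ! k) (js ! k)) = (\<Prod>k<N. G $$ (is ! k, js ! k))"
        using I js by (intro prod.cong refl) (auto simp: tensor_indices_def subset_iff G_def)
      then show "(\<Prod>k<N. g (is ! k) (js ! k)) \<odot> foldr (\<otimes>) (map x is) \<one> =
          ((\<Prod>k<N. G $$ (is ! k, js ! k)) * ?a is) \<odot> w"
        using mult_tensor_eq[OF w x I] wc algebra.smult_assoc1[of "\<Prod>k<N. G $$ (is ! k, js ! k)" "?a is" w]
        by simp
    qed (use wc in auto)
    also have "\<dots> = tensor_act r N G ?a js \<odot> w"
      unfolding tensor_act_def using wc by (intro smult_sum finite_tensor_indices)
    also have "\<dots> = (c * tensor_act r N G ?a js) \<odot> w'"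
      using wc algebra.smult_assoc1[of "tensor_act r N G ?a js" c w'] by (simp add: c mult.commute)
    finally show "foldr (\<otimes>) (map y js) \<one> = (c * tensor_act r N G ?a js) \<odot> w'" .
  qed
  with carrier(1) det \<open>c \<noteq> 0\<close> show ?thesis by (rule that)
qed

end

section \<open>Locality and finite dimension\<close>

lemma (in primeideal) list_prod_mem:
  assumes "set xs \<subseteq> carrier R" "foldr (\<otimes>) xs \<one> \<in> I"
  shows "\<exists>x\<in>set xs. x \<in> I"
  using assms
proof (induction xs)
  case Nil
  then show ?case using I_notcarr one_imp_carrier by simp
next
  case (Cons x xs)
  have "foldr (\<otimes>) xs \<one> \<in> carrier R"
    using Cons.prems(1) by (induction xs) auto
  then show ?case using Cons I_prime[of x "foldr (\<otimes>) xs \<one>"] by auto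
qed

context nilpotent_ideal
begin

text \<open>Each \<open>x\<close> in \<open>I\<close> satisfies \<open>x\<^sup>N\<^sup>+\<^sup>1 = 0\<close>, so it lies in every prime ideal, in particular in \<open>J\<close>.
  Maximality of \<open>I\<close> leaves only \<open>J = I\<close>.\<close>

lemma maximal_ideal_unique:
  assumes "maximalideal I A" "maximalideal J A"
  shows "J = I"
proof -
  interpret I: maximalideal I A by fact
  interpret J: maximalideal J A by fact
  interpret J: primeideal J A using assms(2) by (rule algebra.maximalideal_prime)
  have "I \<subseteq> J"
  proof
    fix x assume x: "x \<in> I"
    have "foldr (\<otimes>) (replicate (N + 1) x) \<one> \<in> ideal_power A I (N + 1)"
      using list_prod_in_ideal_power[of "replicate (N + 1) x"] x by (simp del: replicate_Suc)
    then have "foldr (\<otimes>) (replicate (N + 1) x) \<one> \<in> J"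
      using power_Suc_zero J.zero_closed by simp
    moreover have "set (replicate (N + 1) x) \<subseteq> carrier A"
      using a_Hcarr[OF x] by auto
    ultimately obtain y where "y \<in> set (replicate (N + 1) x)" "y \<in> J"
      using J.list_prod_mem by blast
    then show "x \<in> J" by (metis in_set_replicate)
  qed
  then show ?thesis
    using I.I_maximal[OF J.ideal_axioms _ J.a_subset] J.I_notcarr by auto
qed

lemma high_power_zero:
  assumes "N < n"
  shows "ideal_power A I n = {\<zero>}"
proof -
  have "ideal_power A I n \<subseteq> ideal_power A I (Suc N)"
    using assms
  proof (induction rule: dec_induct[OF Suc_leI, consumes 1])
    case (2 n)
    have "ideal_power A I (Suc n) \<subseteq> ideal_power A I n"
      unfolding ideal_power_Suc using ideal_prod_inter[OF ideal_ideal_power ideal_axioms] by blast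
    then show ?case using 2 by blast
  qed simp
  then show ?thesis
    using power_Suc_zero additive_subgroup.zero_closed[OF ideal.axioms(1)[OF ideal_ideal_power[of n]]] by auto
qed

text \<open>Let \<open>T\<close> be the span of the monomials of positive degree in representatives of a basis of \<open>I/I\<^sup>2\<close>.
  It is closed under multiplication and \<open>I = T + I\<^sup>2\<close>. Multiplying two elements of \<open>I = T + I\<^sup>k\<close>
  shows \<open>I\<^sup>2 \<subseteq> T + I\<^sup>k\<^sup>+\<^sup>1\<close>, so by induction \<open>I = T + I\<^sup>k\<close> for all \<open>k\<close>, and nilpotency gives \<open>I = T\<close>.
  Monomials of degree above \<open>N\<close> vanish, so finitely many monomials span \<open>I\<close>.\<close>

lemma finite_dimensional:
  assumes e: "ordered_basis (cotangent_space A I) r e"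
  obtains k where "has_dim (subspace_of A I) k"
proof -
  obtain x where lifts: "lifts r x e"
    by (rule ordered_basis_lift[OF e])
  then have x: "x i \<in> I" if "i < r" for i
    using that by blast
  define monomials where
    "monomials = {foldr (\<otimes>) (map x is) \<one> | is. is \<noteq> [] \<and> set is \<subseteq> {..<r}}"
  define T where "T = algebra.span monomials"
  have xs: "set (map x is) \<subseteq> I" if "set is \<subseteq> {..<r}" for "is" using that x by auto
  have "monomials \<subseteq> insert \<zero> (\<Union>n\<in>{..N}. (\<lambda>is. foldr (\<otimes>) (map x is) \<one>) ` tensor_indices r n)"
  proof
    fix m assume "m \<in> monomials"
    then obtain "is" where I: "m = foldr (\<otimes>) (map x is) \<one>" "set is \<subseteq> {..<r}"
      by (auto simp: monomials_def)
    show "m \<in> insert \<zero> (\<Union>n\<in>{..N}. (\<lambda>is. foldr (\<otimes>) (map x is) \<one>) ` tensor_indices r n)"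
    proof (cases "length is \<le> N")
      case True
      then show ?thesis using I by (auto simp: tensor_indices_def)
    next
      case False
      then have "m = \<zero>"
        using list_prod_in_ideal_power[OF xs[OF I(2)]] high_power_zero[of "length is"] I(1) by simp
      then show ?thesis by simp
    qed
  qed
  then have finite: "finite monomials"
    by (rule finite_subset) (simp add: finite_tensor_indices)
  have in_I: "monomials \<subseteq> I"
  proof
    fix m assume "m \<in> monomials"
    then obtain i "is" where I: "m = foldr (\<otimes>) (map x (i # is)) \<one>" "i < r" "set is \<subseteq> {..<r}"
      by (auto simp: monomials_def neq_Nil_conv)
    have "set (map x is) \<subseteq> carrier A" using xs[OF I(3)] a_subset by (rule order_trans)
    then have "foldr (\<otimes>) (map x is) \<one> \<in> carrier A" by (rule list_prod_closed)
    then show "m \<in> I"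
      using x[OF I(2)] I(1) by (simp add: I_r_closed)
  qed
  then have in_carrier: "monomials \<subseteq> carrier A" using a_subset by blast
  interpret T: LinearCombinations.submodule complex_field T A
    unfolding T_def using in_carrier by (rule algebra.span_is_submodule)
  have monomials_T: "monomials \<subseteq> T" unfolding T_def using in_carrier by (rule algebra.in_own_span)
  have T_I: "T \<subseteq> I" unfolding T_def using in_I submodule_ideal by (rule algebra.span_is_subset)
  have span_minimal: "T \<subseteq> W" if "monomials \<subseteq> W" "LinearCombinations.submodule complex_field W A" for W
    unfolding T_def using that by (rule algebra.span_is_subset)
  \<comment> \<open>Closure of \<open>T\<close> under products is shown one factor at a time: the elements that \<open>s\<close>
    multiplies into \<open>T\<close> form a subspace, and it contains \<open>T\<close> once it contains the monomials.\<close>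
  have multiplier: "LinearCombinations.submodule complex_field {t \<in> carrier A. s \<otimes> t \<in> T} A"
    if s: "s \<in> carrier A" for s
    using s algebra.module
    by (intro submodule.intro) (auto simp: r_distr mult_smult)
  have "s \<otimes> t \<in> T" if st: "s \<in> monomials" "t \<in> monomials" for s t
  proof -
    obtain "is" js where I: "s = foldr (\<otimes>) (map x is) \<one>" "is \<noteq> []" "set is \<subseteq> {..<r}"
      "t = foldr (\<otimes>) (map x js) \<one>" "js \<noteq> []" "set js \<subseteq> {..<r}"
      using st unfolding monomials_def by blast
    then have "s \<otimes> t = foldr (\<otimes>) (map x (is @ js)) \<one>"
      using list_prod_append[of "map x is" "map x js"] xs[of "is"] xs[of js] a_subset by auto
    then have "s \<otimes> t \<in> monomials" using I unfolding monomials_def by fastforce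
    then show ?thesis using monomials_T by blast
  qed
  then have "s \<otimes> t \<in> T" if "s \<in> monomials" "t \<in> T" for s t
    using that span_minimal[OF _ multiplier[of s]] in_carrier by blast
  then have "t \<otimes> s \<in> T" if "s \<in> monomials" "t \<in> T" for s t
    using that algebra.m_comm[of t s] in_carrier T_I a_subset by (metis subsetD)
  then have T_mult: "s \<otimes> t \<in> T" if "s \<in> T" "t \<in> T" for s t
    using that span_minimal[OF _ multiplier[of s]] in_carrier T_I a_subset by blast
  have T_carrier: "t \<in> carrier A" if "t \<in> T" for t using that T_I a_subset by blast
  have xT: "x i \<in> T" if "i < r" for i
  proof -
    have "x i = foldr (\<otimes>) (map x [i]) \<one>" using x[OF that] a_Hcarr by simp
    then have "x i \<in> monomials" using that unfolding monomials_def by fastforce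
    then show ?thesis using monomials_T by blast
  qed
  have TT: "(\<Oplus>i\<in>{..<r}. c i \<odot> x i) \<in> T" for c
  proof -
    have "(\<Oplus>i\<in>S. c i \<odot> x i) \<in> T" if "finite S" "S \<subseteq> {..<r}" for S
      using that
    proof (induction S rule: finite_induct)
      case (insert j S)
      then have "(\<Oplus>i\<in>insert j S. c i \<odot> x i) = c j \<odot> x j \<oplus> (\<Oplus>i\<in>S. c i \<odot> x i)"
        using x a_Hcarr by (subst finsum_insert) (auto simp: Pi_def)
      then show ?case using insert xT by auto
    qed simp
    then show ?thesis by simp
  qed
  have step2: "\<exists>t\<in>T. y \<ominus> t \<in> ideal_power A I 2" if y: "y \<in> I" for y
  proof -
    obtain c where "cotangent_class y = cotangent_class (\<Oplus>i\<in>{..<r}. c i \<odot> x i)"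
      using cotangent_coordinates[OF e lifts y] by blast
    then show ?thesis
      using cotangent_class_eq_iff TT[of c] T_carrier y a_Hcarr by blast
  qed
  have mod_power: "\<forall>y\<in>I. \<exists>t\<in>T. y \<ominus> t \<in> ideal_power A I (Suc (Suc n))" for n
  proof (induction n)
    case 0
    show ?case using step2 by (simp add: numeral_2_eq_2)
  next
    case (Suc n)
    let ?J = "ideal_power A I (Suc (Suc (Suc n)))"
    interpret J: ideal ?J A by (rule ideal_ideal_power)
    have square: "\<exists>t\<in>T. y \<ominus> t \<in> ?J" if "y \<in> ideal_prod A I I" for y
      using that
    proof (induction rule: ideal_prod.induct)
      case (prod u v)
      obtain s where s: "s \<in> T" "u \<ominus> s \<in> ideal_power A I (Suc (Suc n))" using Suc prod(1) by blast
      obtain t where t: "t \<in> T" "v \<ominus> t \<in> ideal_power A I (Suc (Suc n))" using Suc prod(2) by blast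
      \<comment> \<open>The difference \<open>u v - s t = u (v - t) + (u - s) t\<close> gains one power from the factor in \<open>I\<close>.\<close>
      have "u \<otimes> (v \<ominus> t) \<in> ideal_power A I (Suc 0 + Suc (Suc n))"
        using prod(1) t(2) ideal_power_1 by (intro mult_in_ideal_power) simp_all
      moreover have "(u \<ominus> s) \<otimes> t \<in> ideal_power A I (Suc (Suc n) + Suc 0)"
        using s(2) t(1) T_I ideal_power_1 by (intro mult_in_ideal_power) auto
      ultimately have "u \<otimes> (v \<ominus> t) \<oplus> (u \<ominus> s) \<otimes> t \<in> ?J"
        using J.a_closed by simp
      moreover have "u \<otimes> (v \<ominus> t) \<oplus> (u \<ominus> s) \<otimes> t = u \<otimes> v \<ominus> s \<otimes> t"
        using prod a_Hcarr T_carrier[OF s(1)] T_carrier[OF t(1)] by algebra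
      ultimately show ?case using T_mult[OF s(1) t(1)] by auto
    next
      case (sum y z)
      then obtain s t where "s \<in> T" "y \<ominus> s \<in> ?J" "t \<in> T" "z \<ominus> t \<in> ?J" by blast
      moreover from this have "y \<oplus> z \<ominus> (s \<oplus> t) = (y \<ominus> s) \<oplus> (z \<ominus> t)"
        using sum(1,2) ideal_prod_in_carrier[OF ideal_axioms ideal_axioms] T_carrier[of s] T_carrier[of t]
        by (simp add: subset_iff) algebra
      ultimately show ?case using J.a_closed by (metis T.m_closed)
    qed
    show ?case
    proof
      fix y assume y: "y \<in> I"
      obtain s where s: "s \<in> T" "y \<ominus> s \<in> ideal_power A I 2" using step2[OF y] by blast
      then have "y \<ominus> s \<in> ideal_prod A I I"
        using ideal_power_Suc[of "Suc 0"] ideal_power_1 by (simp add: numeral_2_eq_2)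
      then obtain t where t: "t \<in> T" "(y \<ominus> s) \<ominus> t \<in> ?J" using square by blast
      have "(y \<ominus> s) \<ominus> t = y \<ominus> (s \<oplus> t)"
        using a_Hcarr[OF y] T_carrier[OF s(1)] T_carrier[OF t(1)] by algebra
      then show "\<exists>t\<in>T. y \<ominus> t \<in> ?J" using s t by (metis T.m_closed)
    qed
  qed
  have "I \<subseteq> T"
  proof
    fix y assume y: "y \<in> I"
    then obtain t where t: "t \<in> T" "y \<ominus> t \<in> ideal_power A I (Suc (Suc N))" using mod_power by blast
    then have "y \<ominus> t = \<zero>" using high_power_zero[of "Suc (Suc N)"] by simp
    then have "y = t" using a_Hcarr[OF y] T_carrier[OF t(1)] by (simp add: r_right_minus_eq)
    then show "y \<in> T" using t by simp
  qed
  then have "I = T" using T_I by blast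
  interpret W: vectorspace complex_field "subspace_of A I"
    using algebra.module submodule_ideal by (rule vectorspace_subspace_of)
  have "W.span monomials = algebra.span monomials"
    using in_I submodule_ideal by (rule algebra.span_li_not_depend)
  then have "W.fin_dim"
    unfolding W.fin_dim_def using finite in_I \<open>I = T\<close> by (intro exI[of _ monomials]) (simp add: T_def)
  then show ?thesis using that by (simp add: has_dim_def)
qed

end

section \<open>The moduli algebra\<close>

lemma convergent_power_series_simps:
  "carrier convergent_power_series = {f. convergent_ps f}"
  "f \<otimes>\<^bsub>convergent_power_series\<^esub> g = ps_mult f g"
  "f \<oplus>\<^bsub>convergent_power_series\<^esub> g = (\<lambda>\<alpha>. f \<alpha> + g \<alpha>)"
  "c \<odot>\<^bsub>convergent_power_series\<^esub> f = (\<lambda>\<alpha>. c * f \<alpha>)"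
  by (simp_all add: convergent_power_series_def)

lemma ps_mult_commute: "ps_mult f g = ps_mult g f"
proof
  fix \<gamma> :: "'a \<Rightarrow> nat"
  show "ps_mult f g \<gamma> = ps_mult g f \<gamma>"
    unfolding ps_mult_def
    by (rule sum.reindex_bij_witness[of _ "\<lambda>\<beta> i. \<gamma> i - \<beta> i" "\<lambda>\<beta> i. \<gamma> i - \<beta> i"])
       (auto simp: le_fun_def fun_eq_iff)
qed

text \<open>Once power series form a ring, commutativity is the symmetry of the convolution sum, and scalar
  multiplication is coefficientwise and preserves convergence.\<close>

lemma algebra_convergent_power_series:
  assumes "ring (convergent_power_series :: (complex, 'n::finite power_series) module)"
  shows "Module.algebra complex_field (convergent_power_series :: (complex, 'n power_series) module)"
proof -
  let ?R = "convergent_power_series :: (complex, 'n power_series) module"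
  interpret ring ?R by fact
  have cring: "cring ?R"
    by (intro cring.intro comm_monoid.intro comm_monoid_axioms.intro ring_axioms monoid_axioms)
       (simp add: convergent_power_series_simps ps_mult_commute)
  show ?thesis
  proof (rule algebraI[OF class_cring.cring_axioms cring], goal_cases)
    case (1 c f)
    then obtain \<epsilon> where "\<epsilon> > 0" and sum: "\<forall>z\<in>ball 0 \<epsilon>. ps_term f z summable_on UNIV"
      by (auto simp: convergent_power_series_simps convergent_ps_def)
    have "ps_term (\<lambda>\<alpha>. c * f \<alpha>) z = (\<lambda>\<alpha>. c * ps_term f z \<alpha>)" for z
      by (simp add: ps_term_def fun_eq_iff)
    then have "ps_term (\<lambda>\<alpha>. c * f \<alpha>) z summable_on UNIV" if "z \<in> ball 0 \<epsilon>" for z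
      using sum that by (simp add: summable_on_cmult_right)
    then show ?case
      using \<open>\<epsilon> > 0\<close> by (auto simp: convergent_power_series_simps convergent_ps_def)
  qed (auto simp: convergent_power_series_simps ps_mult_def algebra_simps sum_distrib_left)
qed

text \<open>The ideal that is divided out is the intersection of all ideals containing \<open>f\<close> and its partial
  derivatives. Were there no such ideal, the intersection would be the set of all power series, only
  one residue class would remain, and there could be no maximal ideal. So some ideal contains \<open>f\<close> and
  its derivatives. As it is an ideal of a ring, convergent power series form a ring, the generated set
  is an ideal of it, and the quotient is an algebra.\<close>

lemma algebra_moduli_algebra:
  fixes f :: "'n::finite power_series"
  assumes "maximalideal \<mm> (moduli_algebra f)"
  shows "Module.algebra complex_field (moduli_algebra f)"
proof -
  let ?R = "convergent_power_series :: (complex, 'n power_series) module"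
  define S where "S = insert f (range (\<lambda>i. ps_pderiv i f))"
  have A: "moduli_algebra f = alg_quot ?R (Idl\<^bsub>?R\<^esub> S)"
    by (simp add: moduli_algebra_def S_def)
  interpret \<mm>: maximalideal \<mm> "moduli_algebra f" by fact
  have "\<exists>J. ideal J ?R \<and> S \<subseteq> J"
  proof (rule ccontr)
    assume "\<not> (\<exists>J. ideal J ?R \<and> S \<subseteq> J)"
    then have "{J. ideal J ?R \<and> S \<subseteq> J} = {}" by blast
    then have UNIV: "Idl\<^bsub>?R\<^esub> S = UNIV" by (simp only: genideal_def Inter_empty)
    have "UNIV +>\<^bsub>?R\<^esub> g = UNIV" for g
    proof -
      have "h \<in> UNIV +>\<^bsub>?R\<^esub> g" for h
      proof -
        have "h = (\<lambda>\<alpha>. h \<alpha> - g \<alpha>) \<oplus>\<^bsub>?R\<^esub> g" by (simp add: convergent_power_series_simps)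
        then show ?thesis unfolding a_r_coset_def' by blast
      qed
      then show ?thesis by blast
    qed
    then have trivial: "carrier (moduli_algebra f) \<subseteq> {UNIV}"
      unfolding A UNIV alg_quot_simps A_RCOSETS_def' by blast
    have zero: "\<zero>\<^bsub>moduli_algebra f\<^esub> \<in> \<mm>"
      using \<mm>.is_additive_subgroup by (rule additive_subgroup.zero_closed)
    have "carrier (moduli_algebra f) \<subseteq> \<mm>"
    proof
      fix X assume "X \<in> carrier (moduli_algebra f)"
      then have "X = UNIV" by (rule singletonD[OF subsetD[OF trivial]])
      also have "UNIV = \<zero>\<^bsub>moduli_algebra f\<^esub>"
        using \<mm>.a_Hcarr[OF zero] by (rule singletonD[OF subsetD[OF trivial], symmetric])
      finally show "X \<in> \<mm>" using zero by simp
    qed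
    then have "carrier (moduli_algebra f) = \<mm>"
      using \<mm>.a_subset by (rule equalityI)
    then show False using \<mm>.I_notcarr by simp
  qed
  then obtain J where J: "ideal J ?R" "S \<subseteq> J" by blast
  interpret J: ideal J ?R by fact
  have "ideal (Idl\<^bsub>?R\<^esub> S) ?R"
    using J(2) J.a_subset by (intro J.genideal_ideal) blast
  then interpret algebra_ideal ?R "Idl\<^bsub>?R\<^esub> S"
    by (intro algebra_ideal.intro algebra_convergent_power_series J.ring_axioms)
  show ?thesis
    unfolding A by (rule algebra_alg_quot)
qed

section \<open>Transport along isomorphisms\<close>

locale algebra_isomorphism =
  A: Module.algebra complex_field A + B: Module.algebra complex_field B
  for A :: "(complex, 'a) module" and B :: "(complex, 'b) module" +
  fixes \<phi> :: "'a \<Rightarrow> 'b"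
  assumes iso: "\<phi> \<in> algebra_iso A B"
begin

lemma ring_iso: "\<phi> \<in> ring_iso A B"
  using iso by (simp add: algebra_iso_def)

lemmas closed [simp] = ring_iso_memE(1)[OF ring_iso]
  and mult [simp] = ring_iso_memE(2)[OF ring_iso]
  and add [simp] = ring_iso_memE(3)[OF ring_iso]
  and one [simp] = ring_iso_memE(4)[OF ring_iso]
  and bij = ring_iso_memE(5)[OF ring_iso]

lemma smult [simp]: "x \<in> carrier A \<Longrightarrow> \<phi> (c \<odot>\<^bsub>A\<^esub> x) = c \<odot>\<^bsub>B\<^esub> \<phi> x"
  using iso by (simp add: algebra_iso_def)

lemma inj: "inj_on \<phi> (carrier A)" and image_carrier: "\<phi> ` carrier A = carrier B"
  using bij by (auto simp: bij_betw_def)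

lemma zero [simp]: "\<phi> \<zero>\<^bsub>A\<^esub> = \<zero>\<^bsub>B\<^esub>"
  using ring_hom_zero[of \<phi> A B] ring_iso A.M_cring B.M_cring
  by (auto simp: ring_iso_def cring_def)

lemma inverse: "algebra_isomorphism B A (inv_into (carrier A) \<phi>)"
proof -
  let ?\<psi> = "inv_into (carrier A) \<phi>"
  have \<psi>: "?\<psi> y \<in> carrier A" "\<phi> (?\<psi> y) = y" if "y \<in> carrier B" for y
    using that image_carrier by (auto simp: inv_into_into f_inv_into_f)
  have \<psi>_eq: "?\<psi> y = x" if "x \<in> carrier A" "\<phi> x = y" for x y
    using that inj by (auto intro: inv_into_f_f)
  have "?\<psi> \<in> ring_iso B A"
  proof (rule ring_iso_memI)
    show "bij_betw ?\<psi> (carrier B) (carrier A)"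
      using bij by (rule bij_betw_inv_into)
  qed (use \<psi> in \<open>auto intro!: \<psi>_eq\<close>)
  moreover have "?\<psi> (c \<odot>\<^bsub>B\<^esub> y) = c \<odot>\<^bsub>A\<^esub> ?\<psi> y" if "y \<in> carrier B" for c y
    using \<psi>[OF that] by (auto intro!: \<psi>_eq)
  ultimately show ?thesis
    by (intro algebra_isomorphism.intro algebra_isomorphism_axioms.intro A.algebra_axioms B.algebra_axioms)
       (simp add: algebra_iso_def)
qed

text \<open>The inverse of \<open>\<phi>\<close> is an isomorphism too, so this lemma and the following ones also give the
  corresponding statements about preimages.\<close>

lemma ideal_image:
  assumes "ideal I A"
  shows "ideal (\<phi> ` I) B"
proof -
  interpret I: ideal I A by fact
  have carr: "x \<in> carrier A" if "x \<in> I" for x using that I.a_Hcarr by blast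
  have preimage: "\<exists>x\<in>carrier A. y = \<phi> x" if "y \<in> carrier B" for y
    using that image_carrier by blast
  show ?thesis
  proof (rule idealI)
    show "ring B" using B.M_cring by (rule cring.axioms)
    show "subgroup (\<phi> ` I) (add_monoid B)"
    proof (rule B.M.add.subgroupI)
      show "\<phi> ` I \<subseteq> carrier B" using carr by auto
      show "\<phi> ` I \<noteq> {}" using I.zero_closed by blast
    next
      fix a assume "a \<in> \<phi> ` I"
      then obtain x where x: "x \<in> I" "a = \<phi> x" by blast
      have "\<phi> (\<ominus>\<^bsub>A\<^esub> x) \<oplus>\<^bsub>B\<^esub> a = \<zero>\<^bsub>B\<^esub>"
        using x carr add[of "\<ominus>\<^bsub>A\<^esub> x" x] by (simp add: A.M.l_neg del: add)
      then have "\<ominus>\<^bsub>B\<^esub> a = \<phi> (\<ominus>\<^bsub>A\<^esub> x)"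
        using x carr by (intro B.M.minus_equality) auto
      then show "\<ominus>\<^bsub>B\<^esub> a \<in> \<phi> ` I" using x I.a_inv_closed by blast
    next
      fix a b assume "a \<in> \<phi> ` I" "b \<in> \<phi> ` I"
      then obtain x y where "x \<in> I" "a = \<phi> x" "y \<in> I" "b = \<phi> y" by blast
      then show "a \<oplus>\<^bsub>B\<^esub> b \<in> \<phi> ` I"
        using add[of x y] carr I.a_closed[of x y] by (metis image_eqI)
    qed
  next
    fix a b assume "a \<in> \<phi> ` I" "b \<in> carrier B"
    then obtain x y where xy: "x \<in> I" "a = \<phi> x" "y \<in> carrier A" "b = \<phi> y" using preimage by blast
    show "b \<otimes>\<^bsub>B\<^esub> a \<in> \<phi> ` I" "a \<otimes>\<^bsub>B\<^esub> b \<in> \<phi> ` I"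
      using xy mult[of y x] mult[of x y] carr I.I_l_closed[of x y] I.I_r_closed[of x y]
      by (metis image_eqI)+
  qed
qed

lemma image_ideal_prod:
  assumes "ideal I A" "ideal J A"
  shows "\<phi> ` ideal_prod A I J = ideal_prod B (\<phi> ` I) (\<phi> ` J)"
proof (intro equalityI subsetI)
  have carr: "ideal_prod A I J \<subseteq> carrier A"
    using A.ideal_prod_in_carrier assms by blast
  have IJ: "I \<subseteq> carrier A" "J \<subseteq> carrier A" using assms ideal.Icarr by auto
  fix y
  {
    assume "y \<in> \<phi> ` ideal_prod A I J"
    then obtain x where x: "x \<in> ideal_prod A I J" "y = \<phi> x" by blast
    from x(1) have "\<phi> x \<in> ideal_prod B (\<phi> ` I) (\<phi> ` J)"
    proof (induction rule: ideal_prod.induct)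
      case (prod i j)
      then have "i \<in> carrier A" "j \<in> carrier A" using IJ by auto
      then show ?case using prod by (auto intro!: ideal_prod.prod)
    next
      case (sum s t)
      then have "s \<in> carrier A" "t \<in> carrier A" using carr by auto
      then show ?case using ideal_prod.sum[OF sum.IH] by simp
    qed
    then show "y \<in> ideal_prod B (\<phi> ` I) (\<phi> ` J)" using x(2) by simp
  next
    assume "y \<in> ideal_prod B (\<phi> ` I) (\<phi> ` J)"
    then show "y \<in> \<phi> ` ideal_prod A I J"
    proof (induction rule: ideal_prod.induct)
      case (prod i j)
      then obtain a b where ab: "a \<in> I" "i = \<phi> a" "b \<in> J" "j = \<phi> b" by blast
      then have "a \<in> carrier A" "b \<in> carrier A" using IJ by auto
      then have "i \<otimes>\<^bsub>B\<^esub> j = \<phi> (a \<otimes>\<^bsub>A\<^esub> b)" using ab by simp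
      then show ?case using ideal_prod.prod[OF ab(1,3), of A] by blast
    next
      case (sum s t)
      then obtain a b where ab: "a \<in> ideal_prod A I J" "s = \<phi> a" "b \<in> ideal_prod A I J" "t = \<phi> b" by blast
      then have "a \<in> carrier A" "b \<in> carrier A" using carr by auto
      then have "s \<oplus>\<^bsub>B\<^esub> t = \<phi> (a \<oplus>\<^bsub>A\<^esub> b)" using ab by simp
      then show ?case using ideal_prod.sum[OF ab(1,3)] by blast
    qed
  }
qed

lemma image_ideal_power:
  assumes "ideal I A"
  shows "\<phi> ` ideal_power A I k = ideal_power B (\<phi> ` I) k"
proof -
  interpret I: algebra_ideal A I by (intro algebra_ideal.intro A.algebra_axioms assms)
  interpret J: algebra_ideal B "\<phi> ` I" by (intro algebra_ideal.intro B.algebra_axioms ideal_image assms)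
  show ?thesis
  proof (induction k)
    case 0
    show ?case unfolding I.ideal_power_0 J.ideal_power_0 by (rule image_carrier)
  next
    case (Suc k)
    show ?case unfolding I.ideal_power_Suc J.ideal_power_Suc
      using image_ideal_prod[OF I.ideal_ideal_power assms] Suc by simp
  qed
qed

lemma inv_image: "I \<subseteq> carrier A \<Longrightarrow> inv_into (carrier A) \<phi> ` \<phi> ` I = I"
  using inj by (rule inv_into_image_cancel)

lemma maximalideal_image:
  assumes "maximalideal I A"
  shows "maximalideal (\<phi> ` I) B"
proof -
  interpret I: maximalideal I A by fact
  interpret inv: algebra_isomorphism B A "inv_into (carrier A) \<phi>" by (rule inverse)
  let ?\<psi> = "inv_into (carrier A) \<phi>"
  show ?thesis
  proof (rule maximalidealI)
    show "ideal (\<phi> ` I) B" by (rule ideal_image[OF I.ideal_axioms])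
    show "carrier B \<noteq> \<phi> ` I"
    proof
      assume "carrier B = \<phi> ` I"
      then have "?\<psi> ` \<phi> ` carrier A = ?\<psi> ` \<phi> ` I" using image_carrier by simp
      then show False using I.I_notcarr inv_image I.a_subset by simp
    qed
  next
    fix J assume J: "ideal J B" "\<phi> ` I \<subseteq> J" "J \<subseteq> carrier B"
    have "I \<subseteq> ?\<psi> ` J" using image_mono[OF J(2), of ?\<psi>] inv_image[OF I.a_subset] by simp
    moreover have "?\<psi> ` J \<subseteq> carrier A" using J(3) by auto
    ultimately have "?\<psi> ` J = I \<or> ?\<psi> ` J = carrier A"
      using I.I_maximal inv.ideal_image[OF J(1)] by blast
    moreover have "\<phi> ` ?\<psi> ` J = J"
      using J(3) image_carrier by (simp add: image_inv_into_cancel)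
    ultimately show "J = \<phi> ` I \<or> J = carrier B" using image_carrier by auto
  qed
qed

lemma linear_map_subspace:
  assumes "ideal I A"
  shows "linear_map complex_field (subspace_of A I) (subspace_of B (\<phi> ` I)) \<phi>"
    and "bij_betw \<phi> (carrier (subspace_of A I)) (carrier (subspace_of B (\<phi> ` I)))"
proof -
  interpret I: algebra_ideal A I by (intro algebra_ideal.intro A.algebra_axioms assms)
  interpret J: algebra_ideal B "\<phi> ` I" by (intro algebra_ideal.intro B.algebra_axioms ideal_image assms)
  have "\<phi> \<in> module_hom complex_field (subspace_of A I) (subspace_of B (\<phi> ` I))"
    using I.a_Hcarr by (auto simp: module_hom_def)
  then show "linear_map complex_field (subspace_of A I) (subspace_of B (\<phi> ` I)) \<phi>"
    using vectorspace_subspace_of[OF A.module I.submodule_ideal]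
      vectorspace_subspace_of[OF B.module J.submodule_ideal]
    by (intro linear_map.intro mod_hom.intro mod_hom_axioms.intro) (auto simp: vectorspace_def)
  show "bij_betw \<phi> (carrier (subspace_of A I)) (carrier (subspace_of B (\<phi> ` I)))"
    using inj I.a_subset by (auto simp: bij_betw_def intro: inj_on_subset)
qed

lemma image_coset:
  assumes "J \<subseteq> carrier A" "x \<in> carrier A"
  shows "\<phi> ` (J +>\<^bsub>A\<^esub> x) = \<phi> ` J +>\<^bsub>B\<^esub> \<phi> x"
  using assms by (auto simp: a_r_coset_def' image_UN subset_iff)

text \<open>On \<open>I/I\<^sup>2\<close>, whose elements are cosets, the induced map is the image map, because \<open>\<phi>\<close> maps cosets of
  \<open>I\<^sup>2\<close> onto cosets of the square of the image of \<open>I\<close>.\<close>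

lemma linear_map_cotangent:
  assumes "ideal I A"
  shows "linear_map complex_field (cotangent_space A I) (cotangent_space B (\<phi> ` I)) ((`) \<phi>)"
    and "bij_betw ((`) \<phi>) (carrier (cotangent_space A I)) (carrier (cotangent_space B (\<phi> ` I)))"
proof -
  interpret I: algebra_ideal A I by (intro algebra_ideal.intro A.algebra_axioms assms)
  interpret J: algebra_ideal B "\<phi> ` I" by (intro algebra_ideal.intro B.algebra_axioms ideal_image assms)
  interpret I2: algebra_ideal A "ideal_power A I 2" by (rule I.algebra_ideal_power)
  interpret J2: algebra_ideal B "ideal_power B (\<phi> ` I) 2" by (rule J.algebra_ideal_power)
  have cls: "\<phi> ` I.cotangent_class x = J.cotangent_class (\<phi> x)" if "x \<in> carrier A" for x
    using image_coset[OF I.ideal_power_subset that] image_ideal_power[OF assms] by simp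
  have opsA: "I.cotangent_class x \<oplus>\<^bsub>cotangent_space A I\<^esub> I.cotangent_class y = I.cotangent_class (x \<oplus>\<^bsub>A\<^esub> y)"
    "c \<odot>\<^bsub>cotangent_space A I\<^esub> I.cotangent_class x = I.cotangent_class (c \<odot>\<^bsub>A\<^esub> x)"
    if "x \<in> carrier A" "y \<in> carrier A" for x y c
    using that by (simp_all add: cotangent_space_def alg_quot_simps I2.a_rcos_sum I2.smult_coset)
  have opsB: "J.cotangent_class x \<oplus>\<^bsub>cotangent_space B (\<phi> ` I)\<^esub> J.cotangent_class y = J.cotangent_class (x \<oplus>\<^bsub>B\<^esub> y)"
    "c \<odot>\<^bsub>cotangent_space B (\<phi> ` I)\<^esub> J.cotangent_class x = J.cotangent_class (c \<odot>\<^bsub>B\<^esub> x)"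
    if "x \<in> carrier B" "y \<in> carrier B" for x y c
    using that by (simp_all add: cotangent_space_def alg_quot_simps J2.a_rcos_sum J2.smult_coset)
  have carr: "x \<in> carrier A" if "x \<in> I" for x using that I.a_Hcarr by blast
  have image: "(`) \<phi> ` carrier (cotangent_space A I) = carrier (cotangent_space B (\<phi> ` I))"
    unfolding I.carrier_cotangent_space J.carrier_cotangent_space image_image
    using cls carr by (intro image_cong refl) simp
  have "(`) \<phi> \<in> module_hom complex_field (cotangent_space A I) (cotangent_space B (\<phi> ` I))"
    unfolding module_hom_def
  proof (intro CollectI conjI allI impI)
    show "(`) \<phi> \<in> carrier (cotangent_space A I) \<rightarrow> carrier (cotangent_space B (\<phi> ` I))"
      using image by blast
  next
    fix X Y assume "X \<in> carrier (cotangent_space A I) \<and> Y \<in> carrier (cotangent_space A I)"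
    then obtain x y where "x \<in> I" "X = I.cotangent_class x" "y \<in> I" "Y = I.cotangent_class y"
      by (auto simp: I.carrier_cotangent_space)
    then show "\<phi> ` (X \<oplus>\<^bsub>cotangent_space A I\<^esub> Y) = \<phi> ` X \<oplus>\<^bsub>cotangent_space B (\<phi> ` I)\<^esub> \<phi> ` Y"
      using carr by (simp add: opsA opsB cls)
  next
    fix c X assume "c \<in> carrier complex_field \<and> X \<in> carrier (cotangent_space A I)"
    then obtain x where "x \<in> I" "X = I.cotangent_class x"
      by (auto simp: I.carrier_cotangent_space)
    then show "\<phi> ` (c \<odot>\<^bsub>cotangent_space A I\<^esub> X) = c \<odot>\<^bsub>cotangent_space B (\<phi> ` I)\<^esub> \<phi> ` X"
      using carr by (simp add: opsA(2)[of x x] opsB(2)[of "\<phi> x" "\<phi> x"] cls)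
  qed
  then show "linear_map complex_field (cotangent_space A I) (cotangent_space B (\<phi> ` I)) ((`) \<phi>)"
    using I.vectorspace_cotangent_space J.vectorspace_cotangent_space
    by (intro linear_map.intro mod_hom.intro mod_hom_axioms.intro) (auto simp: vectorspace_def)
  have "X \<subseteq> carrier A" if X: "X \<in> carrier (cotangent_space A I)" for X
  proof -
    obtain x where "x \<in> I" "X = I.cotangent_class x"
      using X unfolding I.carrier_cotangent_space by blast
    then show ?thesis using A.M.a_r_coset_subset_G[OF I2.a_subset, of x] carr by simp
  qed
  then have "inj_on ((`) \<phi>) (carrier (cotangent_space A I))"
    using inj_on_image_eq_iff[OF inj] by (intro inj_onI) simp
  then show "bij_betw ((`) \<phi>) (carrier (cotangent_space A I)) (carrier (cotangent_space B (\<phi> ` I)))"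
    using image by (simp add: bij_betw_def)
qed

lemma list_prod_image:
  "set xs \<subseteq> carrier A \<Longrightarrow> \<phi> (foldr (\<otimes>\<^bsub>A\<^esub>) xs \<one>\<^bsub>A\<^esub>) = foldr (\<otimes>\<^bsub>B\<^esub>) (map \<phi> xs) \<one>\<^bsub>B\<^esub>"
proof (induction xs)
  case (Cons x xs)
  then have "foldr (\<otimes>\<^bsub>A\<^esub>) xs \<one>\<^bsub>A\<^esub> \<in> carrier A" by (induction xs) auto
  then show ?case using Cons by simp
qed simp

lemma nilpotent_ideal_image:
  assumes "nilpotent_ideal A I N"
  shows "nilpotent_ideal B (\<phi> ` I) N"
proof -
  interpret I: nilpotent_ideal A I N by fact
  have "ideal_power B (\<phi> ` I) (N + 1) = {\<zero>\<^bsub>B\<^esub>}"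
    using image_ideal_power[OF I.ideal_axioms, of "N + 1"] I.power_Suc_zero by simp
  then show ?thesis
    by (intro nilpotent_ideal.intro nilpotent_ideal_axioms.intro algebra_ideal.intro
        B.algebra_axioms ideal_image I.ideal_axioms)
qed

lemma top_power_basis_image:
  assumes "ideal I A" "vectorspace.basis complex_field (subspace_of A (ideal_power A I N)) {w}"
  shows "vectorspace.basis complex_field (subspace_of B (ideal_power B (\<phi> ` I) N)) {\<phi> w}"
proof -
  interpret I: algebra_ideal A I by (intro algebra_ideal.intro A.algebra_axioms assms)
  show ?thesis
    using linear_bijection_ordered_basis[OF linear_map_subspace[OF I.ideal_ideal_power[of N]], of "Suc 0" "\<lambda>_. w"] assms
    by (simp add: ordered_basis_singleton image_ideal_power o_def)
qed

text \<open>Applying \<open>\<phi>\<close> to the equations that determine the coefficients in \<open>A\<close> gives the equations that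
  determine them in \<open>B\<close>.\<close>

lemma mult_tensor_image:
  assumes "nilpotent_ideal A I N" "ordered_basis (cotangent_space A I) r e"
    and w: "vectorspace.basis complex_field (subspace_of A (ideal_power A I N)) {w}"
    and js: "js \<in> tensor_indices r N"
  shows "mult_tensor B ((`) \<phi> \<circ> e) (\<phi> w) js = mult_tensor A e w js"
proof -
  interpret I: nilpotent_ideal A I N by fact
  interpret J: nilpotent_ideal B "\<phi> ` I" N by (rule nilpotent_ideal_image[OF assms(1)])
  obtain x where x: "I.lifts r x e"
    by (rule I.ordered_basis_lift[OF assms(2)])
  show ?thesis
  proof (rule J.mult_tensor_eqI[OF top_power_basis_image[OF I.ideal_axioms w], of r "\<phi> \<circ> x"])
    show "J.lifts r (\<phi> \<circ> x) ((`) \<phi> \<circ> e)"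
      using x I.a_Hcarr image_coset[OF I.ideal_power_subset] image_ideal_power[OF I.ideal_axioms] by simp
  next
    show "js \<in> tensor_indices r N" by (rule js)
    have "set (map x js) \<subseteq> carrier A"
      using x js I.a_Hcarr by (auto simp: tensor_indices_def subset_iff)
    then show "foldr (\<otimes>\<^bsub>B\<^esub>) (map (\<phi> \<circ> x) js) \<one>\<^bsub>B\<^esub> = mult_tensor A e w js \<odot>\<^bsub>B\<^esub> \<phi> w"
      using list_prod_image[of "map x js"] I.mult_tensor_eq[OF w x js] I.top_power_generator_closed(2)[OF w]
      by simp
  qed
qed

end

section \<open>Classical invariants under the general linear group\<close>

lemma poly_value_cong:
  assumes "poly_on X P" "\<And>x. x \<in> X \<Longrightarrow> a x = b x"
  shows "poly_value P a = poly_value P b"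
  unfolding poly_value_def
proof (intro sum.cong refl)
  fix \<mu> assume "\<mu> \<in> Poly_Mapping.keys P"
  then have "Poly_Mapping.keys \<mu> \<subseteq> X" using assms(1) by (simp add: poly_on_def)
  then have "(\<Prod>x\<in>Poly_Mapping.keys \<mu>. a x ^ Poly_Mapping.lookup \<mu> x) =
      (\<Prod>x\<in>Poly_Mapping.keys \<mu>. b x ^ Poly_Mapping.lookup \<mu> x)"
    using assms(2) by (intro prod.cong) auto
  then show "Poly_Mapping.lookup P \<mu> * (\<Prod>x\<in>Poly_Mapping.keys \<mu>. a x ^ Poly_Mapping.lookup \<mu> x) =
      Poly_Mapping.lookup P \<mu> * (\<Prod>x\<in>Poly_Mapping.keys \<mu>. b x ^ Poly_Mapping.lookup \<mu> x)"
    by simp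
qed

lemma poly_value_scale:
  assumes "homogeneous d P"
  shows "poly_value P (\<lambda>x. c * a x) = c ^ d * poly_value P a"
  unfolding poly_value_def sum_distrib_left
proof (intro sum.cong refl)
  fix \<mu> assume "\<mu> \<in> Poly_Mapping.keys P"
  then have "(\<Prod>x\<in>Poly_Mapping.keys \<mu>. c ^ Poly_Mapping.lookup \<mu> x) = c ^ d"
    using assms by (simp add: homogeneous_def flip: power_sum)
  then show "Poly_Mapping.lookup P \<mu> * (\<Prod>x\<in>Poly_Mapping.keys \<mu>. (c * a x) ^ Poly_Mapping.lookup \<mu> x) =
      c ^ d * (Poly_Mapping.lookup P \<mu> * (\<Prod>x\<in>Poly_Mapping.keys \<mu>. a x ^ Poly_Mapping.lookup \<mu> x))"
    by (simp add: power_mult_distrib prod.distrib)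
qed

text \<open>Each of the \<open>N\<close> factors of the matrix product contributes one \<open>c\<close>.\<close>

lemma tensor_act_scale_matrix:
  assumes "js \<in> tensor_indices r N" "h \<in> carrier_mat r r"
  shows "tensor_act r N (c \<cdot>\<^sub>m h) a js = c ^ N * tensor_act r N h a js"
  unfolding tensor_act_def sum_distrib_left
proof (intro sum.cong refl)
  fix "is" assume I: "is \<in> tensor_indices r N"
  have "(\<Prod>k<N. (c \<cdot>\<^sub>m h) $$ (is ! k, js ! k)) = (\<Prod>k<N. c * h $$ (is ! k, js ! k))"
  proof (intro prod.cong refl)
    fix k assume "k \<in> {..<N}"
    then have "is ! k < r" "js ! k < r"
      using I assms(1) by (auto simp: tensor_indices_def subset_iff)
    then show "(c \<cdot>\<^sub>m h) $$ (is ! k, js ! k) = c * h $$ (is ! k, js ! k)"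
      using assms(2) by simp
  qed
  then show "(\<Prod>k<N. (c \<cdot>\<^sub>m h) $$ (is ! k, js ! k)) * a is = c ^ N * ((\<Prod>k<N. h $$ (is ! k, js ! k)) * a is)"
    by (simp add: prod.distrib)
qed

text \<open>Write \<open>g = s h\<close> with \<open>s\<close> an \<open>r\<close>-th root of \<open>det g\<close>, so that \<open>det h = 1\<close>. The invariant ignores \<open>h\<close>,
  and \<open>s\<close> multiplies the tensor by \<open>s\<^sup>N\<close>. The order of the quantifiers matters: one \<open>c\<close> serves all
  invariants.\<close>

lemma classical_invariant_general_linear:
  assumes "g \<in> carrier_mat r r" "Determinant.det g \<noteq> 0"
  obtains c where "c \<noteq> 0"
    "\<And>P d a. classical_invariant r N P \<Longrightarrow> homogeneous d P \<Longrightarrow> a \<in> sym_tensors r N \<Longrightarrow>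
      poly_value P (tensor_act r N g a) = c ^ d * poly_value P a"
proof -
  obtain s where s: "s ^ r = Determinant.det g" "s \<noteq> 0"
  \<comment> \<open>For \<open>r = 0\<close> the determinant of the empty matrix is \<open>1\<close>, and there is no root to extract.\<close>
  proof (cases "r = 0")
    case True
    then show ?thesis using that[of 1] assms(1) by simp
  next
    case False
    obtain s where "s ^ r = Determinant.det g"
      using exists_complex_root[OF False, of "Determinant.det g"] by metis
    moreover from this have "s \<noteq> 0" using assms(2) False by (metis power_0_left)
    ultimately show ?thesis by (rule that)
  qed
  define h where "h = inverse s \<cdot>\<^sub>m g"
  have h: "h \<in> carrier_mat r r" using assms(1) by (simp add: h_def)
  have g: "g = s \<cdot>\<^sub>m h" using s(2) assms(1) by (auto simp: h_def)
  have "Determinant.det h = 1"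
    using assms s by (simp add: h_def field_simps)
  show ?thesis
  proof (rule that[of "s ^ N"])
    show "s ^ N \<noteq> 0" using s(2) by simp
  next
    fix P d a
    assume P: "classical_invariant r N P" "homogeneous d P" "a \<in> sym_tensors r N"
    have "poly_value P (tensor_act r N g a) = poly_value P (\<lambda>js. s ^ N * tensor_act r N h a js)"
      using P(1) tensor_act_scale_matrix[OF _ h]
      by (intro poly_value_cong[of "tensor_indices r N"]) (auto simp: g classical_invariant_def)
    also have "\<dots> = (s ^ N) ^ d * poly_value P a"
      using P h \<open>Determinant.det h = 1\<close> by (simp add: poly_value_scale classical_invariant_def)
    finally show "poly_value P (tensor_act r N g a) = (s ^ N) ^ d * poly_value P a" .
  qed
qed

text \<open>Both invariants are multiplied by the same power \<open>(c s)\<^sup>d\<close>, which cancels in the quotient.\<close>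

lemma invariant_ratio_change_of_basis:
  assumes "classical_invariant r N P" "homogeneous d P"
    and "classical_invariant r N Q" "homogeneous d Q"
    and "g \<in> carrier_mat r r" "Determinant.det g \<noteq> 0" "c \<noteq> 0" "a \<in> sym_tensors r N"
    and "\<And>js. js \<in> tensor_indices r N \<Longrightarrow> b js = c * tensor_act r N g a js"
    and "poly_value Q a \<noteq> 0"
  shows "poly_value Q b \<noteq> 0 \<and> poly_value P b / poly_value Q b = poly_value P a / poly_value Q a"
proof -
  obtain s where s: "s \<noteq> 0"
    "\<And>P d a. classical_invariant r N P \<Longrightarrow> homogeneous d P \<Longrightarrow> a \<in> sym_tensors r N \<Longrightarrow>
      poly_value P (tensor_act r N g a) = s ^ d * poly_value P a"
    using classical_invariant_general_linear[OF assms(5,6)] by blast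
  have "poly_value R b = (c * s) ^ d * poly_value R a"
    if "classical_invariant r N R" "homogeneous d R" for R
  proof -
    have "poly_value R b = poly_value R (\<lambda>js. c * tensor_act r N g a js)"
      using that(1) assms(9) by (intro poly_value_cong[of "tensor_indices r N"]) (auto simp: classical_invariant_def)
    then show ?thesis
      using s(2)[OF that assms(8)] by (simp add: poly_value_scale[OF that(2)] power_mult_distrib)
  qed
  then show ?thesis using assms s(1) by simp
qed

section \<open>The absolute invariant\<close>

theorem theorem1:
  fixes V :: "(complex ^ 'n::finite) set"
    and f :: "'n power_series"
    and A :: "(complex, 'n power_series set) module"
    and \<mm> :: "'n power_series set set"
    and N r d :: nat
    and P Q :: tensor_poly
    and e :: "nat \<Rightarrow> 'n power_series set set"
    and w :: "'n power_series set"
    and B :: "(complex, 'b) module"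
    and \<phi> :: "'n power_series set \<Rightarrow> 'b"
  assumes "isolated_singularity V"
    and "hypersurface_germ_generator V f"
    and "A = moduli_algebra f"
    and "maximalideal \<mm> A"
    and "has_dim (subspace_of A (ideal_power A \<mm> N)) 1"
    and "ideal_power A \<mm> (N + 1) = {\<zero>\<^bsub>A\<^esub>}"
    and "ordered_basis (cotangent_space A \<mm>) r e"
    and "vectorspace.basis complex_field (subspace_of A (ideal_power A \<mm> N)) {w}"
    and "classical_invariant r N P" "homogeneous d P"
    and "classical_invariant r N Q" "homogeneous d Q"
    and "poly_value Q (mult_tensor A e w) \<noteq> 0"
    and "Module.algebra complex_field B"
    and "\<phi> \<in> algebra_iso A B"
  shows "(\<exists>!\<nn>. maximalideal \<nn> B) \<and>
    (\<forall>\<nn>. maximalideal \<nn> B \<longrightarrow>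
      (\<exists>k. has_dim (subspace_of A \<mm>) k \<and> has_dim (subspace_of B \<nn>) k) \<and>
      has_dim (subspace_of B (ideal_power B \<nn> N)) 1 \<and>
      ideal_power B \<nn> (N + 1) = {\<zero>\<^bsub>B\<^esub>} \<and>
      has_dim (cotangent_space B \<nn>) r \<and>
      (\<forall>e' w'. ordered_basis (cotangent_space B \<nn>) r e' \<and>
          vectorspace.basis complex_field (subspace_of B (ideal_power B \<nn> N)) {w'} \<longrightarrow>
        poly_value Q (mult_tensor B e' w') \<noteq> 0 \<and>
        poly_value P (mult_tensor B e' w') / poly_value Q (mult_tensor B e' w') =
        poly_value P (mult_tensor A e w) / poly_value Q (mult_tensor A e w))) \<and>
    (\<forall>e' w'. ordered_basis (cotangent_space A \<mm>) r e' \<and>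
        vectorspace.basis complex_field (subspace_of A (ideal_power A \<mm> N)) {w'} \<longrightarrow>
      poly_value Q (mult_tensor A e' w') \<noteq> 0 \<and>
      poly_value P (mult_tensor A e' w') / poly_value Q (mult_tensor A e' w') =
      poly_value P (mult_tensor A e w) / poly_value Q (mult_tensor A e w))"
proof -
  have A: "Module.algebra complex_field A"
    using algebra_moduli_algebra assms(3,4) by blast
  have \<mm>: "ideal \<mm> A" using assms(4) by (rule maximalideal.axioms)
  interpret \<phi>: algebra_isomorphism A B \<phi>
    using A assms(14,15) by (intro algebra_isomorphism.intro algebra_isomorphism_axioms.intro)
  interpret \<psi>: algebra_isomorphism B A "inv_into (carrier A) \<phi>" by (rule \<phi>.inverse)
  let ?\<nn> = "\<phi> ` \<mm>" and ?\<psi> = "inv_into (carrier A) \<phi>"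
  have nilpotent: "nilpotent_ideal A \<mm> N"
    using A \<mm> assms(6) by (intro nilpotent_ideal.intro algebra_ideal.intro nilpotent_ideal_axioms.intro)
  interpret I: nilpotent_ideal A \<mm> N by (rule nilpotent)
  have nilpotent': "nilpotent_ideal B ?\<nn> N" using nilpotent by (rule \<phi>.nilpotent_ideal_image)
  interpret J: nilpotent_ideal B ?\<nn> N by (rule nilpotent')
  have maximal: "maximalideal ?\<nn> B" using assms(4) by (rule \<phi>.maximalideal_image)
  have unique: "\<nn> = ?\<nn>" if "maximalideal \<nn> B" for \<nn>
    using maximal that by (rule J.maximal_ideal_unique)
  have pullback: "?\<psi> ` ?\<nn> = \<mm>" using I.a_subset by (rule \<phi>.inv_image)

  have A_ratio: "poly_value Q (mult_tensor A e' w') \<noteq> 0 \<and>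
      poly_value P (mult_tensor A e' w') / poly_value Q (mult_tensor A e' w') =
      poly_value P (mult_tensor A e w) / poly_value Q (mult_tensor A e w)"
    if e': "ordered_basis (cotangent_space A \<mm>) r e'"
      and w': "vectorspace.basis complex_field (subspace_of A (ideal_power A \<mm> N)) {w'}" for e' w'
  proof -
    obtain g c where "g \<in> carrier_mat r r" "Determinant.det g \<noteq> 0" "c \<noteq> 0"
      "\<And>js. js \<in> tensor_indices r N \<Longrightarrow>
        mult_tensor A e' w' js = c * tensor_act r N g (mult_tensor A e w) js"
      using I.mult_tensor_change_of_basis[OF assms(7) e' assms(8) w'] by blast
    then show ?thesis
      using assms(9-13) I.mult_tensor_symmetric[OF assms(8,7)]
      by (intro invariant_ratio_change_of_basis[of r N P d Q g c "mult_tensor A e w"])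
  qed

  have B_ratio: "poly_value Q (mult_tensor B e' w') \<noteq> 0 \<and>
      poly_value P (mult_tensor B e' w') / poly_value Q (mult_tensor B e' w') =
      poly_value P (mult_tensor A e w) / poly_value Q (mult_tensor A e w)"
    if e': "ordered_basis (cotangent_space B ?\<nn>) r e'"
      and w': "vectorspace.basis complex_field (subspace_of B (ideal_power B ?\<nn> N)) {w'}" for e' w'
  proof -
    \<comment> \<open>Pull the bases of \<open>B\<close> back to \<open>A\<close>, where they are a second choice of bases.\<close>
    let ?e = "(`) ?\<psi> \<circ> e'" and ?w = "?\<psi> w'"
    have "ordered_basis (cotangent_space A \<mm>) r ?e"
      using linear_bijection_ordered_basis[OF \<psi>.linear_map_cotangent[OF J.ideal_axioms] e'] pullback by simp
    moreover have "vectorspace.basis complex_field (subspace_of A (ideal_power A \<mm> N)) {?w}"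
      using \<psi>.top_power_basis_image[OF J.ideal_axioms w'] pullback by simp
    ultimately have "poly_value Q (mult_tensor A ?e ?w) \<noteq> 0 \<and>
        poly_value P (mult_tensor A ?e ?w) / poly_value Q (mult_tensor A ?e ?w) =
        poly_value P (mult_tensor A e w) / poly_value Q (mult_tensor A e w)"
      by (rule A_ratio)
    moreover have "poly_value R (mult_tensor A ?e ?w) = poly_value R (mult_tensor B e' w')"
      if "classical_invariant r N R" for R
      using that \<psi>.mult_tensor_image[OF nilpotent' e' w']
      by (intro poly_value_cong[of "tensor_indices r N"]) (auto simp: classical_invariant_def)
    ultimately show ?thesis using assms(9,11) by simp
  qed

  obtain k where k: "has_dim (subspace_of A \<mm>) k"
    using assms(7) by (rule I.finite_dimensional)
  have "has_dim (subspace_of B ?\<nn>) k"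
    using \<phi>.linear_map_subspace[OF \<mm>] k by (rule linear_bijection_has_dim)
  moreover have "has_dim (subspace_of B (ideal_power B ?\<nn> N)) 1"
    using linear_bijection_has_dim[OF \<phi>.linear_map_subspace[OF I.ideal_ideal_power] assms(5)]
      \<phi>.image_ideal_power[OF \<mm>] by simp
  moreover have "has_dim (cotangent_space B ?\<nn>) r"
    using \<phi>.linear_map_cotangent[OF \<mm>] has_dim_if_ordered_basis[OF I.vectorspace_cotangent_space assms(7)]
    by (rule linear_bijection_has_dim)
  ultimately show ?thesis
    using maximal unique k J.power_Suc_zero A_ratio B_ratio by (intro conjI ex1I[of _ ?\<nn>] allI impI) blast+
qed

end
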